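(* Let $G$ be a finite simple graph with vertex set $V$, and let $\{t,t'\}$ be an exchangeable pair of tubes of $G$. Then $\{t,t'\}$ is extremal if and only if it is maximal, i.e. the inequality $\mathbf h_t+\mathbf h_{t'} > \mathbf h_{t\cup t'}+\sum_{s\in\kappa(t\cap t')}\mathbf h_s$ defines a facet of the closure of the type cone $\mathbb{TC}(\Sigma_G)$ if and only if $t\setminus\{v\}=t'\setminus\{v'\}$ for some vertex $v\in t\setminus t'$ adjacent to a vertex of $t'$ and some vertex $v'\in t'\setminus t$ adjacent to a vertex of $t$.
   Context: A tube of $G$ is a non-empty subset $t\subseteq V$ inducing a connected subgraph of $G$; $\mathcal T_G$ denotes the set of tubes. For $U\subseteq V$, $\kappa(U)$ denotes the set of vertex sets of the connected components of the induced subgraph $G[U]$ (so $\kappa(\varnothing)=\varnothing$), and $\kappa(G)=\kappa(V)$. Two tubes $t,t'$ are compatible if $t\subseteq t'$ or $t'\subseteq t$, or if $t\cap t'=\varnothing$ and $t\cup t'$ is not a tube. A tubing is a set of pairwise compatible tubes containing $\kappa(G)$. If $\mathcal T,\mathcal T'$ are inclusion-maximal tubings with $\mathcal T\setminus\{t\}=\mathcal T'\setminus\{t'\}$ and $t\neq t'$, then $t,t'$ are called exchangeable. Let $\mathbb H=\{x\in\mathbb R^V:\sum_{v\in K}x_v=0 \text{ for all } K\in\kappa(G)\}$, $\pi:\mathbb R^V\to\mathbb H$ the orthogonal projection, and $\mathbf g_t=\pi(\sum_{v\in t}e_v)$ for a tube $t$. The nested fan $\Sigma_G=\{\mathbb R_{\ge0}\{\mathbf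 g_t: t\in\mathcal T\}: \mathcal T \text{ tubing}\}$ is a complete simplicial fan in $\mathbb H$. For $\mathbf h\in\mathbb R^{\mathcal T_G}$ let $P_{\mathbf h}=\{x\in\mathbb H:\langle\mathbf g_t,x\rangle\le\mathbf h_t\ \forall t\in\mathcal T_G\}$. The type cone $\mathbb{TC}(\Sigma_G)$ is the set of $\mathbf h\in\mathbb R^{\mathcal T_G}$ with $\mathbf h_K=0$ for all $K\in\kappa(G)$ such that $\Sigma_G$ is the normal fan (in $\mathbb H$) of $P_{\mathbf h}$; it is an open polyhedral cone, and every $\mathbf h$ in it satisfies the inequality above for every exchangeable pair. An exchangeable pair is called extremal if its inequality defines a facet of the closure of $\mathbb{TC}(\Sigma_G)$, and maximal if the condition on $v,v'$ in the claim holds. *)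

theory Defs
  imports "HOL-Analysis.Analysis"
begin

text \<open>A finite simple graph is given by a symmetric irreflexive adjacency relation \<open>E\<close> on a
  finite type \<open>'v\<close>, so that its vertex set is \<open>UNIV\<close>. For a set \<open>U\<close> of vertices,
  \<open>reach E U\<close> is reachability in the induced subgraph on \<open>U\<close>.\<close>

definition reach :: "('v \<Rightarrow> 'v \<Rightarrow> bool) \<Rightarrow> 'v set \<Rightarrow> 'v \<Rightarrow> 'v \<Rightarrow> bool" where
  "reach E U = (\<lambda>x y. x \<in> U \<and> y \<in> U \<and> E x y)\<^sup>*\<^sup>*"

definition tubes :: "('v \<Rightarrow> 'v \<Rightarrow> bool) \<Rightarrow> 'v set set" where
  "tubes E = {t. t \<noteq> {} \<and> (\<forall>u\<in>t. \<forall>w\<in>t. reach E t u w)}"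

definition components_on :: "('v \<Rightarrow> 'v \<Rightarrow> bool) \<Rightarrow> 'v set \<Rightarrow> 'v set set" where
  "components_on E U = {{w \<in> U. reach E U u w} | u. u \<in> U}"

definition compatible :: "('v \<Rightarrow> 'v \<Rightarrow> bool) \<Rightarrow> 'v set \<Rightarrow> 'v set \<Rightarrow> bool" where
  "compatible E t t' \<longleftrightarrow> t \<subseteq> t' \<or> t' \<subseteq> t \<or> (t \<inter> t' = {} \<and> t \<union> t' \<notin> tubes E)"

definition tubing :: "('v \<Rightarrow> 'v \<Rightarrow> bool) \<Rightarrow> 'v set set \<Rightarrow> bool" where
  "tubing E T \<longleftrightarrow> T \<subseteq> tubes E \<and> components_on E UNIV \<subseteq> T \<and> (\<forall>t\<in>T. \<forall>t'\<in>T. compatible E t t')"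

definition maximal_tubing :: "('v \<Rightarrow> 'v \<Rightarrow> bool) \<Rightarrow> 'v set set \<Rightarrow> bool" where
  "maximal_tubing E T \<longleftrightarrow> tubing E T \<and> (\<forall>T'. tubing E T' \<longrightarrow> T \<subseteq> T' \<longrightarrow> T' = T)"

definition exchangeable :: "('v \<Rightarrow> 'v \<Rightarrow> bool) \<Rightarrow> 'v set \<Rightarrow> 'v set \<Rightarrow> bool" where
  "exchangeable E t t' \<longleftrightarrow> t \<noteq> t' \<and>
     (\<exists>T T'. maximal_tubing E T \<and> maximal_tubing E T' \<and> t \<in> T \<and> t' \<in> T' \<and> T - {t} = T' - {t'})"

definition ambient :: "('v::finite \<Rightarrow> 'v \<Rightarrow> bool) \<Rightarrow> (real ^ 'v) set" where
  "ambient E = {x. \<forall>K \<in> components_on E UNIV. (\<Sum>v\<in>K. x $ v) = 0}"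

definition orth_proj :: "'a::euclidean_space set \<Rightarrow> 'a \<Rightarrow> 'a" where
  "orth_proj S x = (THE y. y \<in> S \<and> (\<forall>z\<in>S. orthogonal (x - y) z))"

lemma orth_proj_unique:
  fixes S :: "'a::euclidean_space set"
  assumes "subspace S"
  shows "\<exists>!y. y \<in> S \<and> (\<forall>z\<in>S. orthogonal (x - y) z)"
proof -
  obtain y z where y: "y \<in> span S" and z: "\<And>w. w \<in> span S \<Longrightarrow> orthogonal z w" and x: "x = y + z"
    using orthogonal_subspace_decomp_exists[of S x] by metis
  have S: "span S = S"
    using assms by (simp add: span_eq_iff)
  show ?thesis
  proof (intro ex1I[of _ y] conjI ballI)
    show "y \<in> S" using y S by simp
    show "orthogonal (x - y) w" if "w \<in> S" for w
      using z[of w] that S x by simp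
    fix y' assume y': "y' \<in> S \<and> (\<forall>z\<in>S. orthogonal (x - y') z)"
    have d: "y - y' \<in> S" using y y' S assms by (simp add: subspace_diff)
    have "(x - y') \<bullet> (y - y') = 0" "(x - y) \<bullet> (y - y') = 0"
      using y' z[of "y - y'"] d S x by (auto simp: orthogonal_def)
    then have "(y - y') \<bullet> (y - y') = 0"
      by (simp add: inner_diff_left)
    then show "y' = y" by simp
  qed
qed

lemma subspace_ambient: "subspace (ambient E)"
  by (auto simp: subspace_def ambient_def sum.distrib simp flip: sum_distrib_left)

definition gvec :: "('v::finite \<Rightarrow> 'v \<Rightarrow> bool) \<Rightarrow> 'v set \<Rightarrow> real ^ 'v" where
  "gvec E t = orth_proj (ambient E) (\<Sum>v\<in>t. axis v 1)"

definition nested_fan :: "('v::finite \<Rightarrow> 'v \<Rightarrow> bool) \<Rightarrow> (real ^ 'v) set set" where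
  "nested_fan E = {convex_cone hull (gvec E ` T) | T. tubing E T}"

text \<open>Outer normal cones, taken inside the subspace \<open>H\<close>.\<close>

definition normal_cone :: "'a::euclidean_space set \<Rightarrow> 'a set \<Rightarrow> 'a set \<Rightarrow> 'a set" where
  "normal_cone H P F = {u \<in> H. \<forall>x\<in>F. \<forall>y\<in>P. u \<bullet> y \<le> u \<bullet> x}"

definition normal_fan :: "'a::euclidean_space set \<Rightarrow> 'a set \<Rightarrow> 'a set set" where
  "normal_fan H P = {normal_cone H P F | F. F face_of P \<and> F \<noteq> {}}"

definition deformation :: "('v::finite \<Rightarrow> 'v \<Rightarrow> bool) \<Rightarrow> real ^ ('v set) \<Rightarrow> (real ^ 'v) set" where
  "deformation E h = {x \<in> ambient E. \<forall>t \<in> tubes E. gvec E t \<bullet> x \<le> h $ t}"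

text \<open>Height vectors indexed by the tubes are encoded as the vectors of \<open>real ^ ('v set)\<close>
  supported on \<open>tubes E\<close>.\<close>

definition type_cone :: "('v::finite \<Rightarrow> 'v \<Rightarrow> bool) \<Rightarrow> (real ^ ('v set)) set" where
  "type_cone E = {h. (\<forall>s. s \<notin> tubes E \<longrightarrow> h $ s = 0) \<and>
     (\<forall>K \<in> components_on E UNIV. h $ K = 0) \<and>
     normal_fan (ambient E) (deformation E h) = nested_fan E}"

definition defines_facet ::
    "('a::euclidean_space \<Rightarrow> real) \<Rightarrow> ('a \<Rightarrow> real) \<Rightarrow> 'a set \<Rightarrow> bool" where
  "defines_facet f g S \<longleftrightarrow> (\<forall>h\<in>S. f h \<ge> g h) \<and> {h \<in> S. f h = g h} facet_of S"

definition extremal_pair :: "('v::finite \<Rightarrow> 'v \<Rightarrow> bool) \<Rightarrow> 'v set \<Rightarrow> 'v set \<Rightarrow> bool" where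
  "extremal_pair E t t' \<longleftrightarrow>
     defines_facet (\<lambda>h. h $ t + h $ t')
       (\<lambda>h. h $ (t \<union> t') + (\<Sum>s \<in> components_on E (t \<inter> t'). h $ s))
       (closure (type_cone E))"

definition maximal_pair :: "('v \<Rightarrow> 'v \<Rightarrow> bool) \<Rightarrow> 'v set \<Rightarrow> 'v set \<Rightarrow> bool" where
  "maximal_pair E t t' \<longleftrightarrow>
     (\<exists>v \<in> t - t'. \<exists>v' \<in> t' - t.
        (\<exists>w\<in>t'. E v w) \<and> (\<exists>w\<in>t. E v' w) \<and> t - {v} = t' - {v'})"

end

theory Submission
  imports Defs
begin

text \<open>
  Write \<open>H(U)\<close> for the sum of \<open>h\<close> over the components of \<open>U\<close>, and call two incompatible tubes
  \<open>a\<close>, \<open>b\<close> crossing, with gap \<open>h a + h b - h (a \<union> b) - H(a \<inter> b)\<close>. The closure of the type cone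
  turns out to be the cone of all \<open>h\<close> with nonnegative gaps.

  If all gaps are positive, then \<open>H\<close> is submodular and the deformation is its base polytope. The
  tubes that are tight at a point form a tubing, since two crossing tubes are never both tight.
  Conversely every tubing is the exact set of tight tubes of some point: the greedy algorithm makes
  a given tubing tight, and a tube outside the tubing fails to be tight as soon as the tubing is
  enlarged by a tube crossing it. With Farkas' lemma the normal fan is then the nested fan. In the
  other direction, if the normal fan is the nested fan, then the tubing formed by \<open>a \<union> b\<close> and the
  components of \<open>a \<inter> b\<close> is tight at a common point, which forces the gap of \<open>a\<close>, \<open>b\<close> to be
  nonnegative.

  In an exchangeable pair, \<open>t - t'\<close> has a single vertex \<open>v\<close> adjacent to \<open>t'\<close>. If \<open>t - t' \<noteq> {v}\<close>,
  some other vertex \<open>w\<close> can be removed from \<open>t\<close>, and the gap of \<open>t\<close>, \<open>t'\<close> is the sum of the two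
  linearly independent gaps of \<open>t - {w}\<close>, \<open>t'\<close> and of \<open>t\<close>, \<open>t \<union> t' - {w}\<close>, so it defines no
  facet. If \<open>t - {v} = t' - {v'}\<close>, an explicit \<open>h\<close> has gap zero at \<open>t\<close>, \<open>t'\<close> only.
\<close>

subsection \<open>Tubes and components\<close>

lemma reach_mono: "reach E U x y \<Longrightarrow> U \<subseteq> W \<Longrightarrow> reach E W x y"
  unfolding reach_def by (erule rtranclp_mono[THEN predicate2D, rotated]) auto

lemma reach_sym: "symp E \<Longrightarrow> reach E U x y \<Longrightarrow> reach E U y x"
proof -
  assume "symp E"
  then have "symp (\<lambda>x y. x \<in> U \<and> y \<in> U \<and> E x y)" by (auto simp: symp_def)
  then have "symp (reach E U)" unfolding reach_def by (rule symp_rtranclp)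
  then show "reach E U x y \<Longrightarrow> reach E U y x" by (auto dest: sympD)
qed

lemma reach_trans: "reach E U x y \<Longrightarrow> reach E U y z \<Longrightarrow> reach E U x z"
  unfolding reach_def by (rule rtranclp_trans)

lemma reach_closed:
  assumes "reach E U x y" "x \<in> X" "\<And>a b. a \<in> X \<Longrightarrow> b \<in> U \<Longrightarrow> E a b \<Longrightarrow> b \<in> X"
  shows "y \<in> X"
  using assms(1) unfolding reach_def
  by (induction rule: rtranclp_induct) (use assms in auto)

lemma reach_step: "reach E U x y \<Longrightarrow> y \<in> U \<Longrightarrow> z \<in> U \<Longrightarrow> E y z \<Longrightarrow> reach E U x z"
  unfolding reach_def by (erule rtranclp.rtrancl_into_rtrancl) auto

lemma tube_nonempty: "t \<in> tubes E \<Longrightarrow> t \<noteq> {}"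
  by (simp add: tubes_def)

text \<open>The set reached from \<open>u\<close> would otherwise be a cut without outgoing edge.
  With the converse \<open>tube_cut\<close>, connectedness is handled by cuts instead of
  paths.\<close>

lemma tubeI_cut:
  assumes "t \<noteq> {}"
    and "\<And>X. X \<subseteq> t \<Longrightarrow> X \<noteq> {} \<Longrightarrow> X \<noteq> t \<Longrightarrow> \<exists>x\<in>X. \<exists>y\<in>t - X. E x y"
  shows "t \<in> tubes E"
proof -
  have "reach E t u w" if "u \<in> t" "w \<in> t" for u w
  proof (rule ccontr)
    assume no: "\<not> reach E t u w"
    let ?X = "{x \<in> t. reach E t u x}"
    have "u \<in> ?X" using that by (simp add: reach_def)
    then have "?X \<noteq> {}" by blast
    moreover have "w \<notin> ?X" using no by simp
    then have "?X \<noteq> t" using \<open>w \<in> t\<close> by metis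
    moreover have "?X \<subseteq> t" by (rule Collect_restrict)
    ultimately obtain x y where "x \<in> ?X" "y \<in> t - ?X" "E x y"
      using assms(2)[of ?X] by meson
    then show False using reach_step[of E t u x y] by auto
  qed
  then show ?thesis using assms(1) by (auto simp: tubes_def)
qed

lemma tube_cut:
  assumes "t \<in> tubes E" "X \<subseteq> t" "X \<noteq> {}" "X \<noteq> t"
  shows "\<exists>x\<in>X. \<exists>y\<in>t - X. E x y"
proof (rule ccontr)
  assume no: "\<not> ?thesis"
  obtain u w where "u \<in> X" "w \<in> t - X" using assms by blast
  then have "reach E t u w" using assms by (auto simp: tubes_def)
  then have "w \<in> X" using \<open>u \<in> X\<close> by (rule reach_closed) (use no in auto)
  then show False using \<open>w \<in> t - X\<close> by simp
qed

lemma singleton_tube: "{x} \<in> tubes E"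
  by (rule tubeI_cut) auto

locale undirected_graph =
  fixes E :: "'v::finite \<Rightarrow> 'v \<Rightarrow> bool"
  assumes sym: "symp E"
begin

lemma edge_sym: "E x y \<Longrightarrow> E y x"
  using sym by (rule sympD)

lemma component_iff:
  "K \<in> components_on E U \<longleftrightarrow> K \<in> tubes E \<and> K \<subseteq> U \<and> (\<forall>x\<in>K. \<forall>y\<in>U - K. \<not> E x y)"
proof
  assume "K \<in> components_on E U"
  then obtain u where u: "u \<in> U" "K = {w \<in> U. reach E U u w}"
    by (auto simp: components_on_def)
  have uK: "u \<in> K" using u by (simp add: reach_def)
  have clo: "\<forall>x\<in>K. \<forall>y\<in>U - K. \<not> E x y"
    using u reach_step[of E U u] by auto
  have "K \<in> tubes E"
  proof (rule tubeI_cut)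
    show "K \<noteq> {}" using uK by blast
    fix X assume X: "X \<subseteq> K" "X \<noteq> {}" "X \<noteq> K"
    show "\<exists>x\<in>X. \<exists>y\<in>K - X. E x y"
    proof (rule ccontr)
      assume no: "\<not> ?thesis"
      obtain x z where xz: "x \<in> X" "z \<in> K - X" using X by blast
      have "reach E U x u" "reach E U u z"
        using xz X u reach_sym[OF sym] by auto
      then have "reach E U x z" by (rule reach_trans)
      then have "z \<in> X" using \<open>x \<in> X\<close>
        by (rule reach_closed) (use no clo X in blast)
      then show False using xz by simp
    qed
  qed
  then show "K \<in> tubes E \<and> K \<subseteq> U \<and> (\<forall>x\<in>K. \<forall>y\<in>U - K. \<not> E x y)"
    using clo u by auto
next
  assume K: "K \<in> tubes E \<and> K \<subseteq> U \<and> (\<forall>x\<in>K. \<forall>y\<in>U - K. \<not> E x y)"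
  then obtain u where u: "u \<in> K" by (auto simp: tubes_def)
  have "K = {w \<in> U. reach E U u w}"
  proof (intro equalityI subsetI)
    fix w assume "w \<in> K"
    then have "reach E K u w" using K u by (auto simp: tubes_def)
    then have "reach E U u w" by (rule reach_mono) (use K in simp)
    then show "w \<in> {w \<in> U. reach E U u w}" using K \<open>w \<in> K\<close> by auto
  next
    fix w assume "w \<in> {w \<in> U. reach E U u w}"
    then have "reach E U u w" by simp
    then show "w \<in> K" using u by (rule reach_closed) (use K in blast)
  qed
  then show "K \<in> components_on E U" using u K by (auto simp: components_on_def)
qed

lemma component_tube: "K \<in> components_on E U \<Longrightarrow> K \<in> tubes E"
  and component_subset: "K \<in> components_on E U \<Longrightarrow> K \<subseteq> U"
  and component_closed: "K \<in> components_on E U \<Longrightarrow> x \<in> K \<Longrightarrow> y \<in> U \<Longrightarrow> E x y \<Longrightarrow> y \<in> K"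
  by (auto simp: component_iff)

lemma tube_in_component:
  assumes "K \<in> components_on E U" "s \<in> tubes E" "s \<subseteq> U" "s \<inter> K \<noteq> {}"
  shows "s \<subseteq> K"
proof (rule ccontr)
  assume "\<not> s \<subseteq> K"
  then have "s \<inter> K \<noteq> s" by blast
  then obtain x y where "x \<in> s \<inter> K" "y \<in> s - s \<inter> K" "E x y"
    using tube_cut[of s E "s \<inter> K"] assms by blast
  then show False using component_closed[OF assms(1), of x y] assms(3) by blast
qed

lemma component_eqI:
  assumes "K \<in> components_on E U" "L \<in> components_on E U" "K \<inter> L \<noteq> {}"
  shows "K = L"
  using tube_in_component[of K U L] tube_in_component[of L U K] assms
    component_tube component_subset by (metis inf_commute subset_antisym)

lemma obtain_component:
  assumes "u \<in> U" obtains K where "K \<in> components_on E U" "u \<in> K"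
proof -
  have "{w \<in> U. reach E U u w} \<in> components_on E U" using assms by (auto simp: components_on_def)
  moreover have "u \<in> {w \<in> U. reach E U u w}" using assms by (auto simp: reach_def)
  ultimately show ?thesis using that by blast
qed

lemma Union_components: "\<Union>(components_on E U) = U"
  using obtain_component component_subset by blast

lemma disjoint_components: "pairwise disjnt (components_on E U)"
  by (auto simp: pairwise_def disjnt_def dest: component_eqI)

lemma components_empty: "components_on E {} = {}"
  by (auto simp: components_on_def)

lemma components_tube: "t \<in> tubes E \<Longrightarrow> components_on E t = {t}"
proof
  assume t: "t \<in> tubes E"
  show 1: "{t} \<subseteq> components_on E t" using t by (simp add: component_iff)
  show "components_on E t \<subseteq> {t}"
  proof
    fix K assume K: "K \<in> components_on E t"
    then have "K \<inter> t \<noteq> {}" using component_subset[OF K] tube_nonempty[OF component_tube[OF K]] by blast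
    then show "K \<in> {t}" using K 1 component_eqI by blast
  qed
qed

text \<open>A component of \<open>X\<close> is connected inside \<open>Y\<close>, so it sits in a
  single component \<open>b\<close> of \<open>Y\<close>; conversely no edge inside \<open>Y\<close>
  leaves \<open>b\<close>.\<close>

lemma components_refine:
  assumes "X \<subseteq> Y"
  shows "components_on E X = (\<Union>b\<in>components_on E Y. components_on E (X \<inter> b))"
proof (intro equalityI subsetI)
  fix K assume K: "K \<in> components_on E X"
  obtain u where u: "u \<in> K" using K component_tube tube_nonempty by blast
  then have "u \<in> Y" using K assms component_subset by blast
  then obtain b where b: "b \<in> components_on E Y" "u \<in> b" by (rule obtain_component)
  have "K \<subseteq> b"
    using tube_in_component[OF b(1), of K] K u b component_tube component_subset assms by blast
  then have "K \<in> components_on E (X \<inter> b)" using K by (auto simp: component_iff)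
  then show "K \<in> (\<Union>b\<in>components_on E Y. components_on E (X \<inter> b))" using b by blast
next
  fix K assume "K \<in> (\<Union>b\<in>components_on E Y. components_on E (X \<inter> b))"
  then obtain b where b: "b \<in> components_on E Y" "K \<in> components_on E (X \<inter> b)" by blast
  have "\<not> E x y" if "x \<in> K" "y \<in> X - K" for x y
  proof
    assume "E x y"
    moreover have "x \<in> b" "y \<in> Y" using that b component_subset assms by blast+
    ultimately have "y \<in> b" using component_closed b(1) by blast
    then show False using \<open>E x y\<close> that b(2) component_closed[OF b(2), of x y] by blast
  qed
  then show "K \<in> components_on E X"
    using component_tube[OF b(2)] component_subset[OF b(2)] unfolding component_iff by blast
qed

text \<open>An edgeless cut of the union cannot split \<open>a\<close> or \<open>b\<close>, so it
  would separate \<open>a\<close> from \<open>b\<close>, against the common vertex or the connecting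
  edge.\<close>

lemma tube_Un:
  assumes "a \<in> tubes E" "b \<in> tubes E" "a \<inter> b \<noteq> {} \<or> (\<exists>x\<in>a. \<exists>y\<in>b. E x y)"
  shows "a \<union> b \<in> tubes E"
proof (rule tubeI_cut)
  show "a \<union> b \<noteq> {}" using assms tube_nonempty by blast
  fix X assume X: "X \<subseteq> a \<union> b" "X \<noteq> {}" "X \<noteq> a \<union> b"
  show "\<exists>x\<in>X. \<exists>y\<in>a \<union> b - X. E x y"
  proof (rule ccontr)
    assume no: "\<not> ?thesis"
    have "X \<inter> a = {} \<or> X \<inter> a = a"
      using tube_cut[OF assms(1), of "X \<inter> a"] no by blast
    moreover have "X \<inter> b = {} \<or> X \<inter> b = b"
      using tube_cut[OF assms(2), of "X \<inter> b"] no by blast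
    ultimately have "X = a \<and> a \<inter> b = {} \<or> X = b \<and> a \<inter> b = {}" using X by blast
    then show False using assms(3) no edge_sym by blast
  qed
qed

lemma tube_edge:
  assumes "a \<in> tubes E" "b \<in> tubes E" "a \<union> b \<in> tubes E" "a \<inter> b = {}"
  shows "\<exists>x\<in>a. \<exists>y\<in>b. E x y"
  using tube_cut[OF assms(3), of a] assms tube_nonempty by blast

lemma tube_insert:
  assumes "a \<in> tubes E" "x \<in> a" "E x y" shows "insert y a \<in> tubes E"
  using tube_Un[OF assms(1) singleton_tube[of y]] assms by auto

section \<open>Crossing tubes and compatibility\<close>

definition crossing :: "'v set \<Rightarrow> 'v set \<Rightarrow> bool" where
  "crossing a b \<longleftrightarrow>
     a \<in> tubes E \<and> b \<in> tubes E \<and> a \<union> b \<in> tubes E \<and> \<not> a \<subseteq> b \<and> \<not> b \<subseteq> a"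

lemma crossing_iff:
  assumes "a \<in> tubes E" "b \<in> tubes E"
  shows "crossing a b \<longleftrightarrow> \<not> compatible E a b"
  using assms tube_Un[of a b] unfolding crossing_def compatible_def by blast

lemma compatible_sym: "compatible E a b \<Longrightarrow> compatible E b a"
  by (auto simp: compatible_def Un_commute)

lemma compatible_edge:
  assumes "compatible E a b" "a \<in> tubes E" "b \<in> tubes E" "x \<in> a" "y \<in> b" "x = y \<or> E x y"
  shows "a \<subseteq> b \<or> b \<subseteq> a"
  using assms tube_Un[of a b] unfolding compatible_def by blast

lemma tubing_insert:
  assumes "tubing E T" "w \<in> tubes E" "\<And>s. s \<in> T \<Longrightarrow> compatible E w s"
  shows "tubing E (insert w T)"
  using assms compatible_sym by (auto simp: tubing_def) (auto simp: compatible_def)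

lemma components_compatible:
  assumes "a \<in> components_on E U" "b \<in> components_on E U" shows "compatible E a b"
proof (rule ccontr)
  assume no: "\<not> compatible E a b"
  then have "a \<union> b \<in> tubes E"
    using crossing_iff[of a b] assms component_tube crossing_def by blast
  moreover have "(a \<union> b) \<inter> a \<noteq> {}"
    using tube_nonempty[OF component_tube[OF assms(1)]] by blast
  ultimately have "b \<subseteq> a"
    using tube_in_component[OF assms(1), of "a \<union> b"] assms[THEN component_subset] by simp
  then show False using no by (auto simp: compatible_def)
qed

lemma tubing_components: "tubing E (components_on E UNIV)"
  using component_tube components_compatible by (auto simp: tubing_def)

lemma tubing_tube: "tubing E T \<Longrightarrow> t \<in> T \<Longrightarrow> t \<in> tubes E"
  and tubing_compatible: "tubing E T \<Longrightarrow> t \<in> T \<Longrightarrow> s \<in> T \<Longrightarrow> compatible E t s"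
  and tubing_component: "tubing E T \<Longrightarrow> K \<in> components_on E UNIV \<Longrightarrow> K \<in> T"
  by (auto simp: tubing_def)

end

subsection \<open>Normal cones of polyhedra\<close>

lemma small_multiple_less:
  fixes c d :: "'i \<Rightarrow> real"
  assumes "finite I" "\<And>i. i \<in> I \<Longrightarrow> 0 < c i"
  obtains e where "e > 0" "\<And>i. i \<in> I \<Longrightarrow> e * d i < c i"
proof -
  have "\<forall>\<^sub>F e in at_right 0. \<forall>i\<in>I. e * d i < c i"
    using assms(1)
  proof (rule eventually_ball_finite)
    show "\<forall>i\<in>I. \<forall>\<^sub>F e in at_right 0. e * d i < c i"
    proof
      fix i assume "i \<in> I"
      have "((\<lambda>e. e * d i) \<longlongrightarrow> 0 * d i) (at_right 0)" by (intro tendsto_intros)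
      then show "\<forall>\<^sub>F e in at_right 0. e * d i < c i"
        by (rule order_tendstoD) (use assms \<open>i \<in> I\<close> in auto)
    qed
  qed
  moreover have "\<forall>\<^sub>F e in at_right (0::real). e > 0" by (rule eventually_at_right_less)
  ultimately have "\<forall>\<^sub>F e in at_right 0. e > 0 \<and> (\<forall>i\<in>I. e * d i < c i)"
    by (rule eventually_conj[rotated])
  then obtain e where "e > 0 \<and> (\<forall>i\<in>I. e * d i < c i)"
    using eventually_happens trivial_limit_at_right_real by blast
  then show ?thesis using that by blast
qed

lemma convex_cone_normal_cone:
  assumes "subspace H" shows "convex_cone (normal_cone H P F)"
  unfolding convex_cone_iff normal_cone_def using assms
  by (auto simp: subspace_0 subspace_add subspace_scale inner_add_left add_mono mult_left_mono)

text \<open>Farkas' lemma inside \<open>H\<close>: for \<open>u\<close> outside the cone of active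
  constraint vectors, a separating vector yields a direction that stays in \<open>P\<close> for a
  short step and increases \<open>u\<close>.\<close>

lemma normal_cone_singleton_eq:
  fixes g :: "'i \<Rightarrow> 'a::euclidean_space"
  assumes H: "subspace H" and I: "finite I" and g: "\<And>i. i \<in> I \<Longrightarrow> g i \<in> H"
    and P: "P = {x \<in> H. \<forall>i\<in>I. g i \<bullet> x \<le> h i}" and x: "x \<in> P"
  shows "normal_cone H P {x} = convex_cone hull (g ` {i \<in> I. g i \<bullet> x = h i})"
    (is "?N = convex_cone hull ?G")
proof
  show "convex_cone hull ?G \<subseteq> ?N"
  proof (rule hull_minimal)
    show "?G \<subseteq> ?N" using g P by (auto simp: normal_cone_def)
  qed (rule convex_cone_normal_cone[OF H])
  show "?N \<subseteq> convex_cone hull ?G"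
  proof
    fix u assume u: "u \<in> ?N"
    then have uH: "u \<in> H" by (simp add: normal_cone_def)
    show "u \<in> convex_cone hull ?G"
    proof (rule ccontr)
      assume "u \<notin> convex_cone hull ?G"
      moreover have "closed (convex_cone hull ?G)" "convex (convex_cone hull ?G)"
        using I by (auto intro: closed_convex_cone_hull convex_convex_cone_hull)
      ultimately obtain a b where ab: "a \<bullet> u < b" "\<forall>k\<in>convex_cone hull ?G. a \<bullet> k > b"
        using separating_hyperplane_closed_point by blast
      have b: "b < 0" using ab(2) convex_cone_hull_contains_0 by fastforce
      \<comment> \<open>A negative value on \<open>k\<close> could be scaled along the ray of
        \<open>k\<close> to exactly \<open>b\<close>, which separation forbids.\<close>
      have ak: "a \<bullet> k \<ge> 0" if "k \<in> convex_cone hull ?G" for k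
      proof (rule ccontr)
        assume neg: "\<not> a \<bullet> k \<ge> 0"
        then have "(b / (a \<bullet> k)) *\<^sub>R k \<in> convex_cone hull ?G"
          using b that by (intro convex_cone_hull_mul) (auto simp: divide_nonpos_nonpos)
        then have "a \<bullet> ((b / (a \<bullet> k)) *\<^sub>R k) > b" using ab by blast
        then show False using neg by simp
      qed
      \<comment> \<open>Only the component \<open>y\<close> of \<open>a\<close> in \<open>H\<close>
        matters: it has the same inner products with vectors of \<open>H\<close>, and moving along
        \<open>- y\<close> does not leave \<open>H\<close>.\<close>
      obtain y z where y: "y \<in> span H" and z: "\<And>w. w \<in> span H \<Longrightarrow> orthogonal z w" and a: "a = y + z"
        using orthogonal_subspace_decomp_exists[of H a] by metis
      have yH: "y \<in> H" using y H by (metis span_eq_iff)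
      have ya: "y \<bullet> w = a \<bullet> w" if "w \<in> H" for w
        using z[of w] that a by (simp add: span_base orthogonal_def inner_add_left)
      define J where "J = {i \<in> I. g i \<bullet> x < h i}"
      obtain e where e: "e > 0" "\<And>i. i \<in> J \<Longrightarrow> e * (- (g i \<bullet> y)) < h i - g i \<bullet> x"
        using small_multiple_less[of J "\<lambda>i. h i - g i \<bullet> x" "\<lambda>i. - (g i \<bullet> y)"] I
        by (auto simp: J_def)
      have "x - e *\<^sub>R y \<in> P"
      proof -
        have "x - e *\<^sub>R y \<in> H" using x P yH H by (auto intro: subspace_diff subspace_scale)
        moreover have "g i \<bullet> (x - e *\<^sub>R y) \<le> h i" if "i \<in> I" for i
        proof (cases "i \<in> J")
          case True
          then show ?thesis using e(2)[of i] by (simp add: inner_diff_right)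
        next
          case False
          then have act: "g i \<bullet> x = h i" using that x P by (force simp: J_def)
          then have "g i \<in> convex_cone hull ?G" using that by (intro hull_inc) auto
          then have "a \<bullet> g i \<ge> 0" by (rule ak)
          then have "g i \<bullet> y \<ge> 0" using ya[OF g[OF that]] by (simp add: inner_commute)
          then show ?thesis using act e(1) by (simp add: inner_diff_right)
        qed
        ultimately show ?thesis using P by simp
      qed
      then have "u \<bullet> (x - e *\<^sub>R y) \<le> u \<bullet> x" using u by (simp add: normal_cone_def)
      then have "u \<bullet> y \<ge> 0" using e(1) by (simp add: inner_diff_right zero_le_mult_iff)
      then have "a \<bullet> u \<ge> 0" using ya[OF uH] by (simp add: inner_commute)
      then show False using ab b by simp
    qed
  qed
qed

text \<open>A relative interior point \<open>x\<close> represents the face: the segment from any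
  \<open>y\<close> in \<open>F\<close> to \<open>x\<close> can be prolonged within \<open>F\<close>,
  so a functional maximal at \<open>x\<close> cannot be smaller at \<open>y\<close>.\<close>

lemma normal_cone_face_singleton:
  fixes P :: "'a::euclidean_space set"
  assumes "convex P" "F face_of P" "F \<noteq> {}"
  obtains x where "x \<in> F" "normal_cone H P F = normal_cone H P {x}"
proof -
  have cF: "convex F" and FP: "F \<subseteq> P" using assms face_of_imp_convex face_of_imp_subset by blast+
  obtain x where x: "x \<in> rel_interior F" using assms cF rel_interior_eq_empty by blast
  have xF: "x \<in> F" using x rel_interior_subset by blast
  have "u \<in> normal_cone H P F" if u: "u \<in> normal_cone H P {x}" for u
  proof -
    have "u \<bullet> w \<le> u \<bullet> y" if "y \<in> F" "w \<in> P" for y w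
    proof -
      obtain e where e: "e > 1" "(1 - e) *\<^sub>R y + e *\<^sub>R x \<in> F"
        using convex_rel_interior_iff[OF cF assms(3)] x \<open>y \<in> F\<close> by blast
      then have "u \<bullet> ((1 - e) *\<^sub>R y + e *\<^sub>R x) \<le> u \<bullet> x"
        using u FP by (auto simp: normal_cone_def)
      then have "(e - 1) * (u \<bullet> x) \<le> (e - 1) * (u \<bullet> y)"
        by (simp add: inner_add_right algebra_simps)
      then have "u \<bullet> x \<le> u \<bullet> y" using e(1) by simp
      moreover have "u \<bullet> w \<le> u \<bullet> x" using u that by (auto simp: normal_cone_def)
      ultimately show ?thesis by simp
    qed
    then show ?thesis using u by (auto simp: normal_cone_def)
  qed
  then have "normal_cone H P F = normal_cone H P {x}"
    using xF by (auto simp: normal_cone_def)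
  then show ?thesis using xF that by blast
qed

lemma tight_face_of:
  assumes "convex P" and le: "\<And>i x. i \<in> J \<Longrightarrow> x \<in> P \<Longrightarrow> g i \<bullet> x \<le> h i"
  shows "{x \<in> P. \<forall>i\<in>J. g i \<bullet> x = h i} face_of P"
proof -
  have "P \<inter> {x. g i \<bullet> x = h i} face_of P" if "i \<in> J" for i
    using face_of_Int_supporting_hyperplane_le[OF assms(1)] le that by blast
  then have "\<Inter>(insert P ((\<lambda>i. P \<inter> {x. g i \<bullet> x = h i}) ` J)) face_of P"
    using assms(1) by (intro face_of_Inter) (auto intro: face_of_refl)
  moreover have "\<Inter>(insert P ((\<lambda>i. P \<inter> {x. g i \<bullet> x = h i}) ` J)) = {x \<in> P. \<forall>i\<in>J. g i \<bullet> x = h i}"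
    by auto
  ultimately show ?thesis by simp
qed

subsection \<open>Dimension counts\<close>

lemma subspace_Int_kernel:
  fixes f :: "'a::real_vector \<Rightarrow> real"
  assumes "subspace L" "linear f"
  shows "subspace (L \<inter> {x. f x = 0})"
  using assms by (auto simp: subspace_def linear_0 linear_add linear_scale)

lemma dim_Int_kernel:
  fixes f :: "'a::euclidean_space \<Rightarrow> real"
  assumes L: "subspace L" and f: "linear f" and e: "e \<in> L" "f e \<noteq> 0"
  shows "dim L = dim (L \<inter> {x. f x = 0}) + 1"
proof -
  let ?M = "L \<inter> {x. f x = 0}"
  have M: "subspace ?M" using L f by (rule subspace_Int_kernel)
  have "L = span (insert e ?M)"
  proof
    show "span (insert e ?M) \<subseteq> L" using L e by (intro span_minimal) auto
    show "L \<subseteq> span (insert e ?M)"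
    proof
      fix x assume "x \<in> L"
      let ?c = "f x / f e"
      have "x - ?c *\<^sub>R e \<in> ?M" using \<open>x \<in> L\<close> e f L
        by (auto simp: linear_diff linear_scale intro: subspace_diff subspace_scale)
      then have "x - ?c *\<^sub>R e \<in> span (insert e ?M)" "?c *\<^sub>R e \<in> span (insert e ?M)"
        by (auto intro: span_base span_scale)
      then have "(x - ?c *\<^sub>R e) + ?c *\<^sub>R e \<in> span (insert e ?M)" by (rule span_add)
      then show "x \<in> span (insert e ?M)" by simp
    qed
  qed
  then have "dim L = dim (insert e ?M)" by (metis dim_span)
  moreover have "e \<notin> span ?M"
  proof
    assume "e \<in> span ?M"
    moreover have "span ?M \<subseteq> ?M" using M by (intro span_minimal) auto
    ultimately show False using e(2) by blast
  qed
  ultimately show ?thesis by (simp add: dim_insert)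
qed

text \<open>The affine hull is all of \<open>L\<close>, since each \<open>x\<close> lies on the line
  through \<open>c\<close> and a point \<open>c + e *\<^sub>R (x - c)\<close> of
  \<open>S\<close>.\<close>

lemma aff_dim_absorbing:
  fixes L :: "'a::euclidean_space set"
  assumes L: "subspace L" and S: "S \<subseteq> L" "c \<in> S"
    and abs: "\<And>d. d \<in> L \<Longrightarrow> \<exists>e>0. c + e *\<^sub>R d \<in> S"
  shows "aff_dim S = int (dim L)"
proof -
  have "L \<subseteq> affine hull S"
  proof
    fix x assume "x \<in> L"
    then have "x - c \<in> L" using L S by (auto intro: subspace_diff)
    then obtain e where e: "e > 0" "c + e *\<^sub>R (x - c) \<in> S" using abs by blast
    have "(1 - 1/e) *\<^sub>R c + (1/e) *\<^sub>R (c + e *\<^sub>R (x - c)) \<in> affine hull S"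
      using S(2) e(2) by (intro mem_affine[OF affine_affine_hull]) (auto intro: hull_inc)
    moreover have "(1 - 1/e) *\<^sub>R c + (1/e) *\<^sub>R (c + e *\<^sub>R (x - c)) = x"
      using e(1) by (simp add: algebra_simps)
    ultimately show "x \<in> affine hull S" by simp
  qed
  moreover have "affine hull S \<subseteq> L"
    using S L by (intro hull_minimal) (auto simp: subspace_imp_affine)
  ultimately have "affine hull S = L" by blast
  then show ?thesis using aff_dim_subspace[OF L] aff_dim_affine_hull[of S] by simp
qed

subsection \<open>Submodularity and tight points\<close>

context undirected_graph
begin

text \<open>The extension of \<open>f\<close> from tubes to all vertex sets that is written
  \<open>H(U)\<close> above.\<close>

definition csum :: "('v set \<Rightarrow> real) \<Rightarrow> 'v set \<Rightarrow> real" where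
  "csum f U = (\<Sum>s\<in>components_on E U. f s)"

definition gap :: "('v set \<Rightarrow> real) \<Rightarrow> 'v set \<Rightarrow> 'v set \<Rightarrow> real" where
  "gap f a b = f a + f b - f (a \<union> b) - csum f (a \<inter> b)"

lemma csum_tube: "t \<in> tubes E \<Longrightarrow> csum f t = f t"
  by (simp add: csum_def components_tube)

lemma csum_empty: "csum f {} = 0"
  by (simp add: csum_def components_empty)

lemma csum_sum: "csum (sum x) U = sum x U"
proof -
  have "sum x (\<Union>(components_on E U)) = csum (sum x) U"
    unfolding csum_def using component_eqI by (subst sum.Union_disjoint) auto
  then show ?thesis by (simp add: Union_components)
qed

lemma csum_mono: "(\<And>s. s \<in> tubes E \<Longrightarrow> f s \<le> g s) \<Longrightarrow> csum f U \<le> csum g U"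
  unfolding csum_def by (intro sum_mono) (auto dest: component_tube)

lemma csum_refine:
  assumes "X \<subseteq> Y"
  shows "csum f X = (\<Sum>b\<in>components_on E Y. csum f (X \<inter> b))"
proof -
  have "components_on E (X \<inter> b) \<inter> components_on E (X \<inter> b') = {}"
    if bb: "b \<in> components_on E Y" "b' \<in> components_on E Y" "b \<noteq> b'" for b b'
  proof (rule ccontr)
    assume "\<not> ?thesis"
    then obtain K where K: "K \<in> components_on E (X \<inter> b)" "K \<in> components_on E (X \<inter> b')" by blast
    then have "K \<noteq> {}" "K \<subseteq> b \<inter> b'"
      using component_tube tube_nonempty component_subset by blast+
    then show False using component_eqI[OF bb(1,2)] bb(3) by blast
  qed
  then show ?thesis unfolding csum_def components_refine[OF assms]
    by (intro sum.UNION_disjoint) auto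
qed

text \<open>Inserting \<open>v\<close> affects only the component \<open>c\<close> that contains it;
  the other components contribute equally to both sums.\<close>

lemma csum_insert:
  assumes "v \<notin> Y" and c: "c \<in> components_on E (insert v Y)" "v \<in> c"
  shows "csum f (insert v Y) - csum f Y = f c - csum f (c - {v})"
proof -
  let ?K = "components_on E (insert v Y)"
  have "csum f Y = (\<Sum>b\<in>?K. csum f (Y \<inter> b))" by (rule csum_refine) auto
  also have "\<dots> = csum f (Y \<inter> c) + (\<Sum>b\<in>?K - {c}. csum f (Y \<inter> b))"
    using c by (simp add: sum.remove)
  also have "(\<Sum>b\<in>?K - {c}. csum f (Y \<inter> b)) = (\<Sum>b\<in>?K - {c}. f b)"
  proof (rule sum.cong)
    fix b assume b: "b \<in> ?K - {c}"
    then have "v \<notin> b" using component_eqI[of b _ c] c by blast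
    then have "Y \<inter> b = b" using b component_subset by blast
    then show "csum f (Y \<inter> b) = f b" using b component_tube csum_tube by auto
  qed simp
  also have "Y \<inter> c = c - {v}" using c assms(1) component_subset by blast
  finally show ?thesis using c by (simp add: csum_def sum.remove)
qed

lemma component_delete_edge:
  assumes "c \<in> tubes E" "v \<in> c" "b \<in> components_on E (c - {v})"
  shows "\<exists>x\<in>b. E x v"
proof -
  have "b \<subseteq> c - {v}" "b \<noteq> {}" using assms component_subset component_tube tube_nonempty by blast+
  moreover have "b \<noteq> c" using calculation assms by blast
  ultimately obtain x y where "x \<in> b" "y \<in> c - b" "E x y" using tube_cut[OF assms(1), of b] by blast
  moreover then have "y = v" using component_closed[OF assms(3), of x y] by blast
  ultimately show ?thesis by blast
qed

text \<open>Submodularity for tubes: \<open>a\<close> grows to \<open>c\<close> by absorbing the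
  components of \<open>c - {v}\<close> one at a time, each by one crossing inequality. The overlap
  terms add up to \<open>csum f (a - {v})\<close>.\<close>

lemma tube_exchange:
  assumes sub: "\<And>a b. crossing a b \<Longrightarrow> gap f a b \<ge> 0"
    and a: "a \<in> tubes E" and c: "c \<in> tubes E" and ac: "a \<subseteq> c" and v: "v \<in> a"
  shows "f c + csum f (a - {v}) \<le> f a + csum f (c - {v})"
proof -
  let ?K = "components_on E (c - {v})"
  have "a \<union> \<Union>B \<in> tubes E \<and> f (a \<union> \<Union>B) + (\<Sum>b\<in>B. csum f (a \<inter> b)) \<le> f a + sum f B"
    if "B \<subseteq> ?K" for B
    using finite[of B] that
  proof (induction B rule: finite_induct)
    case empty
    then show ?case using a by simp
  next
    case (insert b B)
    let ?A = "a \<union> \<Union>B"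
    have A: "?A \<in> tubes E" "f ?A + (\<Sum>b\<in>B. csum f (a \<inter> b)) \<le> f a + sum f B"
      using insert by auto
    have b: "b \<in> ?K" "B \<subseteq> ?K" using insert by auto
    have bt: "b \<in> tubes E" using b component_tube by blast
    have dis: "b \<inter> \<Union>B = {}"
    proof (rule ccontr)
      assume "\<not> ?thesis"
      then obtain b' where "b' \<in> B" "b \<inter> b' \<noteq> {}" by blast
      then show False using component_eqI[of b _ b'] b insert.hyps by blast
    qed
    \<comment> \<open>An edge from \<open>b\<close> to \<open>v\<close>, which lies in
      \<open>a\<close>, keeps the enlarged set connected.\<close>
    obtain x where "x \<in> b" "E x v" using component_delete_edge[OF c _ b(1)] v ac by blast
    then have Ab: "?A \<union> b \<in> tubes E"
      using tube_Un[OF A(1) bt] v edge_sym by blast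
    have Ib: "?A \<inter> b = a \<inter> b" using dis by blast
    have "f (?A \<union> b) + csum f (a \<inter> b) \<le> f ?A + f b"
    proof (cases "b \<subseteq> ?A")
      case True
      then have "a \<inter> b = b" "?A \<union> b = ?A" using dis by blast+
      then show ?thesis using csum_tube[OF bt] by simp
    next
      case False
      have "v \<notin> b" using component_subset[OF b(1)] by blast
      then have "crossing ?A b" using False A bt Ab v by (auto simp: crossing_def)
      then show ?thesis using sub[of ?A b] Ib by (simp add: gap_def)
    qed
    moreover have "a \<union> \<Union>(insert b B) = ?A \<union> b" by blast
    ultimately show ?case using Ab A(2) insert.hyps by simp
  qed
  from this[of ?K] have "f (a \<union> \<Union>?K) + (\<Sum>b\<in>?K. csum f (a \<inter> b)) \<le> f a + sum f ?K" by blast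
  moreover have "a \<union> \<Union>?K = c" using Union_components v ac by blast
  moreover have "csum f (a - {v}) = (\<Sum>b\<in>?K. csum f ((a - {v}) \<inter> b))"
    using ac by (intro csum_refine) auto
  moreover have "(\<Sum>b\<in>?K. csum f ((a - {v}) \<inter> b)) = (\<Sum>b\<in>?K. csum f (a \<inter> b))"
  proof (rule sum.cong)
    fix b assume "b \<in> ?K"
    then have "(a - {v}) \<inter> b = a \<inter> b" using component_subset by blast
    then show "csum f ((a - {v}) \<inter> b) = csum f (a \<inter> b)" by simp
  qed simp
  ultimately show ?thesis by (simp add: csum_def)
qed

text \<open>Diminishing returns, that is submodularity of \<open>csum f\<close>: both increments are
  local to the component of \<open>v\<close>, where \<open>tube_exchange\<close> compares
  them.\<close>

lemma csum_marginal:
  assumes sub: "\<And>a b. crossing a b \<Longrightarrow> gap f a b \<ge> 0" and "X \<subseteq> Y" "v \<notin> Y"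
  shows "csum f (insert v Y) - csum f Y \<le> csum f (insert v X) - csum f X"
proof -
  obtain c where c: "c \<in> components_on E (insert v Y)" "v \<in> c"
    using obtain_component[of v "insert v Y"] by blast
  obtain a where a: "a \<in> components_on E (insert v X)" "v \<in> a"
    using obtain_component[of v "insert v X"] by blast
  have "a \<subseteq> c"
    using tube_in_component[OF c(1) component_tube[OF a(1)]] component_subset[OF a(1)] a c assms(2)
    by blast
  then have "f c + csum f (a - {v}) \<le> f a + csum f (c - {v})"
    using tube_exchange[OF sub] component_tube a c by blast
  then show ?thesis using csum_insert[OF _ c] csum_insert[OF _ a] assms by fastforce
qed

section \<open>Greedy points of the base polytope\<close>

text \<open>Edmonds' greedy algorithm: along the order \<open>r\<close>, each vertex receives the
  increment of \<open>csum f\<close> when it is added. Diminishing returns give the upper bounds by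
  removing top vertices, and on initial segments the increments telescope.\<close>

lemma greedy_point:
  fixes r :: "'v \<Rightarrow> nat"
  assumes sub: "\<And>a b. crossing a b \<Longrightarrow> gap f a b \<ge> 0" and r: "inj r"
  obtains x where "\<And>U. sum x U \<le> csum f U"
    and "\<And>U. (\<And>v w. v \<in> U \<Longrightarrow> r w \<le> r v \<Longrightarrow> w \<in> U) \<Longrightarrow> sum x U = csum f U"
proof -
  define R where "R v = {w. r w < r v}" for v
  define x where "x v = csum f (insert v (R v)) - csum f (R v)" for v
  have vR: "v \<notin> R v" for v by (simp add: R_def)
  have top: "\<exists>v\<in>U. U - {v} \<subseteq> R v" if U: "U \<noteq> {}" for U :: "'v set"
  proof -
    have "Max (r ` U) \<in> r ` U" using U by simp
    then obtain v where v: "v \<in> U" "r v = Max (r ` U)" by force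
    then have "r w \<le> r v" if "w \<in> U" for w using that by simp
    moreover have "r w \<noteq> r v" if "w \<noteq> v" for w using r that by (auto dest: injD)
    ultimately have "U - {v} \<subseteq> R v" unfolding R_def by (auto simp: order.strict_iff_order)
    then show ?thesis using v(1) by blast
  qed
  have "sum x U \<le> csum f U" for U
    using finite[of U]
  proof (induction U rule: finite_psubset_induct)
    case (psubset U)
    show ?case
    proof (cases "U = {}")
      case False
      then obtain v where v: "v \<in> U" "U - {v} \<subseteq> R v" using top by blast
      have "sum x (U - {v}) \<le> csum f (U - {v})" using psubset.IH[of "U - {v}"] v by blast
      moreover have "x v \<le> csum f (insert v (U - {v})) - csum f (U - {v})"
        unfolding x_def by (rule csum_marginal[OF sub v(2) vR])
      moreover have "insert v (U - {v}) = U" using v by blast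
      ultimately show ?thesis using v by (simp add: sum.remove[of U v x])
    qed (simp add: csum_empty)
  qed
  moreover have "(\<forall>v w. v \<in> U \<longrightarrow> r w \<le> r v \<longrightarrow> w \<in> U) \<longrightarrow> sum x U = csum f U" for U
    using finite[of U]
  proof (induction U rule: finite_psubset_induct)
    case (psubset U)
    show ?case
    proof (intro impI)
      assume down: "\<forall>v w. v \<in> U \<longrightarrow> r w \<le> r v \<longrightarrow> w \<in> U"
      show "sum x U = csum f U"
      proof (cases "U = {}")
        case False
        then obtain v where v: "v \<in> U" "U - {v} \<subseteq> R v" using top by blast
        \<comment> \<open>For a down-closed \<open>U\<close> the part below its top vertex is all of
          \<open>R v\<close>, so \<open>x v\<close> is exactly the missing increment.\<close>
        have "w \<in> U - {v}" if "w \<in> R v" for w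
          using that v(1) down vR by (metis Diff_iff R_def mem_Collect_eq order_less_imp_le singletonD)
        then have eq: "U - {v} = R v" using v(2) by blast
        have "sum x (U - {v}) = csum f (U - {v})"
        proof -
          have "U - {v} \<subset> U" using v(1) by blast
          moreover have "\<forall>y w. y \<in> U - {v} \<longrightarrow> r w \<le> r y \<longrightarrow> w \<in> U - {v}"
            unfolding eq by (auto simp: R_def)
          ultimately show ?thesis using psubset.IH[of "U - {v}"] by blast
        qed
        moreover have "insert v (R v) = U" using v eq by blast
        moreover have "sum x U = x v + sum x (U - {v})" using v(1) by (simp add: sum.remove)
        ultimately show ?thesis by (simp add: x_def eq)
      qed (simp add: csum_empty)
    qed
  qed
  ultimately show ?thesis using that by blast
qed

text \<open>A tube of \<open>T\<close> containing a neighbour \<open>y\<close> outside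
  \<open>t\<close> is nested with \<open>t\<close>, hence contains \<open>t\<close> properly. So
  fewer tubes of \<open>T\<close> contain \<open>y\<close> than contain \<open>t\<close>.\<close>

lemma tubing_level_component:
  assumes T: "tubing E T" "t \<in> T"
  shows "t \<in> components_on E {v. card {s \<in> T. t \<subseteq> s} \<le> card {s \<in> T. v \<in> s}}"
    (is "_ \<in> components_on E ?U")
proof -
  have "t \<subseteq> ?U" by (auto intro!: card_mono)
  moreover have "\<not> E x y" if xy: "x \<in> t" "y \<in> ?U - t" for x y
  proof
    assume "E x y"
    have "{s \<in> T. y \<in> s} \<subseteq> {s \<in> T. t \<subseteq> s} - {t}"
    proof
      fix s assume "s \<in> {s \<in> T. y \<in> s}"
      then have s: "s \<in> T" "y \<in> s" by auto
      then have "t \<subseteq> s \<or> s \<subseteq> t"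
        using compatible_edge[of t s x y] tubing_compatible[OF T(1,2)] tubing_tube[OF T(1)]
          T(2) xy \<open>E x y\<close> by blast
      then show "s \<in> {s \<in> T. t \<subseteq> s} - {t}" using s xy by blast
    qed
    then have "{s \<in> T. y \<in> s} \<subset> {s \<in> T. t \<subseteq> s}" using T(2) by blast
    then have "card {s \<in> T. y \<in> s} < card {s \<in> T. t \<subseteq> s}" by (simp add: psubset_card_mono)
    then show False using xy by simp
  qed
  ultimately show ?thesis using tubing_tube[OF T] by (auto simp: component_iff)
qed

text \<open>The greedy order takes vertices in many tubes of \<open>T\<close> first. Level sets of
  the count are then tight, and so are their components, since no slack is negative; by
  \<open>tubing_level_component\<close> every tube of \<open>T\<close> is such a component.\<close>

lemma tubing_point:
  assumes sub: "\<And>a b. crossing a b \<Longrightarrow> gap f a b \<ge> 0" and T: "tubing E T"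
  obtains x where "\<And>t. t \<in> tubes E \<Longrightarrow> sum x t \<le> f t" "\<And>t. t \<in> T \<Longrightarrow> sum x t = f t"
proof -
  define u where "u v = card {s \<in> T. v \<in> s}" for v
  obtain e :: "'v \<Rightarrow> nat" and M where e: "e ` UNIV = {i. i < M}" "inj e"
    using finite_imp_inj_to_nat_seg[OF finite[of "UNIV :: 'v set"]] by blast
  \<comment> \<open>A lexicographic order: \<open>M\<close> exceeds all values of \<open>e\<close>,
    which only breaks ties between equal counts.\<close>
  define r where "r v = (card T - u v) * M + e v" for v
  have eM: "e v < M" for v using e(1) by blast
  have uT: "u v \<le> card T" for v unfolding u_def by (rule card_mono) auto
  have ru: "u v \<le> u w" if "r w \<le> r v" for v w
  proof (rule ccontr)
    assume "\<not> u v \<le> u w"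
    then have "card T - u v + 1 \<le> card T - u w" using uT[of v] uT[of w] by linarith
    then have "(card T - u v + 1) * M \<le> (card T - u w) * M" by (rule mult_right_mono) simp
    then have "(card T - u v) * M + M \<le> (card T - u w) * M" by simp
    then show False using that eM[of v] by (simp add: r_def)
  qed
  have "inj r"
  proof (rule injI)
    fix v w assume vw: "r v = r w"
    then have "u v = u w" using ru[of v w] ru[of w v] by simp
    then show "v = w" using vw e(2) by (simp add: r_def inj_eq)
  qed
  then obtain x where x: "\<And>U. sum x U \<le> csum f U"
    and tight: "\<And>U. (\<And>v w. v \<in> U \<Longrightarrow> r w \<le> r v \<Longrightarrow> w \<in> U) \<Longrightarrow> sum x U = csum f U"
    using greedy_point[OF sub, of r] by blast
  have le: "sum x t \<le> f t" if "t \<in> tubes E" for t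
    using x[of t] csum_tube[OF that] by simp
  have "sum x t = f t" if t: "t \<in> T" for t
  proof -
    let ?U = "{v. card {s \<in> T. t \<subseteq> s} \<le> u v}"
    have tU: "t \<in> components_on E ?U"
      using tubing_level_component[OF T t] by (simp add: u_def)
    have "csum (sum x) ?U = csum f ?U"
      unfolding csum_sum using ru by (intro tight) (auto intro: order_trans)
    then have "(\<Sum>s\<in>components_on E ?U. f s - sum x s) = 0"
      by (simp add: csum_def sum_subtractf)
    then have "\<forall>s\<in>components_on E ?U. f s - sum x s = 0"
      using le component_tube by (subst (asm) sum_nonneg_eq_0_iff) auto
    then show ?thesis using tU by auto
  qed
  then show ?thesis using that le by blast
qed

text \<open>\<open>sum x\<close> is modular, so at a point below \<open>f\<close> tightness at both
  tubes would make the gap nonpositive.\<close>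

lemma crossing_not_tight:
  assumes le: "\<And>t. t \<in> tubes E \<Longrightarrow> sum x t \<le> f t"
    and "crossing a b" "gap f a b > 0" "sum x a = f a"
  shows "sum x b < f b"
proof -
  have "sum x a + sum x b = sum x (a \<union> b) + sum x (a \<inter> b)"
    by (simp add: sum.union_inter)
  also have "sum x (a \<union> b) \<le> f (a \<union> b)" using assms le by (simp add: crossing_def)
  also have "sum x (a \<inter> b) \<le> csum f (a \<inter> b)"
    using csum_mono[of "sum x" f, OF le] csum_sum[of x "a \<inter> b"] by metis
  finally show ?thesis using assms(3,4) by (simp add: gap_def)
qed

section \<open>Enlarging a tubing\<close>

text \<open>Every tube of \<open>T\<close> properly inside \<open>t\<close> avoids \<open>a\<close>,
  so it lies in the component \<open>w\<close> or apart from it. Tubes apart from \<open>t\<close>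
  are apart from its subset \<open>w\<close>.\<close>

lemma component_delete_compatible:
  assumes T: "tubing E T" "t \<in> T" and a: "a \<in> t" "\<And>c. c \<in> T \<Longrightarrow> c \<subset> t \<Longrightarrow> a \<notin> c"
    and w: "w \<in> components_on E (t - {a})" and q: "q \<in> T"
  shows "compatible E w q"
proof -
  have wt: "w \<subseteq> t - {a}" "w \<in> tubes E" "w \<noteq> {}"
    using w component_subset component_tube tube_nonempty by blast+
  have qt: "q \<in> tubes E" "t \<in> tubes E" using T q tubing_tube by blast+
  consider "t \<subseteq> q" | "q \<subset> t" | "q \<inter> t = {}" "q \<union> t \<notin> tubes E"
    using tubing_compatible[OF T(1) q T(2)] unfolding compatible_def by blast
  then show ?thesis
  proof cases
    case 1
    then show ?thesis using wt by (auto simp: compatible_def)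
  next
    case 2
    then have "q \<subseteq> t - {a}" using a q by blast
    then have "w \<union> q \<subseteq> w" if "w \<union> q \<in> tubes E"
      using tube_in_component[OF w that] wt by blast
    then show ?thesis using tube_Un[OF wt(2) qt(1)] by (auto simp: compatible_def)
  next
    case 3
    have "w \<union> q \<notin> tubes E"
    proof
      assume "w \<union> q \<in> tubes E"
      moreover have "w \<inter> q = {}" using 3 wt by blast
      ultimately obtain x y where "x \<in> w" "y \<in> q" "E x y" using tube_edge wt qt by blast
      then have "q \<union> t \<in> tubes E" using tube_Un[OF qt] wt edge_sym by blast
      then show False using 3 by simp
    qed
    then show ?thesis using 3 wt by (auto simp: compatible_def)
  qed
qed

text \<open>If tubes of \<open>T\<close> properly inside \<open>t\<close> covered \<open>s\<close>,
  take a maximal one meeting \<open>s\<close>: an edge of \<open>s\<close> leaving it would lead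
  into another one, nested with it and hence larger.\<close>

lemma exists_own_vertex:
  assumes T: "tubing E T" and s: "s \<in> tubes E" and min: "\<And>c. c \<in> T \<Longrightarrow> c \<subset> t \<Longrightarrow> \<not> s \<subseteq> c"
  shows "\<exists>a\<in>s. \<forall>c\<in>T. c \<subset> t \<longrightarrow> a \<notin> c"
proof (rule ccontr)
  assume "\<not> ?thesis"
  then have cov: "\<exists>c\<in>T. c \<subset> t \<and> a \<in> c" if "a \<in> s" for a using that by blast
  define D where "D = {c \<in> T. c \<subset> t \<and> c \<inter> s \<noteq> {}}"
  have "D \<noteq> {}" using cov tube_nonempty[OF s] unfolding D_def by blast
  then obtain c where cD: "c \<in> D" and max: "\<And>d. d \<in> D \<Longrightarrow> c \<subseteq> d \<Longrightarrow> c = d"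
    using finite_has_maximal[OF finite, of D] by blast
  then have c: "c \<in> T" "c \<subset> t" "c \<inter> s \<noteq> {}" unfolding D_def by auto
  have "s \<inter> c \<noteq> s" using min[of c] c by blast
  then obtain y z where yz: "y \<in> s \<inter> c" "z \<in> s - s \<inter> c" "E y z"
    using tube_cut[OF s, of "s \<inter> c"] c by blast
  then obtain d where d: "d \<in> T" "d \<subset> t" "z \<in> d" using cov by blast
  have "c \<subseteq> d \<or> d \<subseteq> c"
    using compatible_edge[of c d y z] tubing_compatible[OF T] tubing_tube[OF T] c d yz by blast
  moreover have "d \<in> D" unfolding D_def using d yz by blast
  ultimately show False using max[of d] d yz by blast
qed

text \<open>In a minimal tube \<open>t\<close> of \<open>T\<close> around \<open>s\<close>, take a
  vertex \<open>a\<close> of \<open>s\<close> in no smaller tube of \<open>T\<close>. A component of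
  \<open>t - {a}\<close> reaching outside \<open>s\<close> is compatible with \<open>T\<close>; it
  crosses \<open>s\<close>, being adjacent to \<open>a\<close> without containing it.\<close>

lemma exists_crossing_extension:
  assumes T: "tubing E T" and s: "s \<in> tubes E" "s \<notin> T"
  obtains w where "tubing E (insert w T)" "crossing w s"
proof -
  obtain p where p: "p \<in> s" using s tube_nonempty by blast
  obtain K where K: "K \<in> components_on E UNIV" "p \<in> K" using obtain_component[of p UNIV] by blast
  have "s \<subseteq> K" using tube_in_component[OF K(1) s(1)] p K by blast
  then have "{t \<in> T. s \<subseteq> t} \<noteq> {}" using tubing_component[OF T K(1)] by blast
  then obtain t where t: "t \<in> T" "s \<subseteq> t" and min: "\<And>c. c \<in> T \<Longrightarrow> s \<subseteq> c \<Longrightarrow> c \<subseteq> t \<Longrightarrow> c = t"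
    using finite_has_minimal[of "{t \<in> T. s \<subseteq> t}"] by (auto simp: eq_commute)
  have tt: "t \<in> tubes E" using tubing_tube[OF T t(1)] .
  have "\<exists>a\<in>s. \<forall>c\<in>T. c \<subset> t \<longrightarrow> a \<notin> c"
    by (rule exists_own_vertex[OF T s(1)]) (use min in blast)
  then obtain a where a: "a \<in> s" "\<And>c. c \<in> T \<Longrightarrow> c \<subset> t \<Longrightarrow> a \<notin> c" by blast
  have "s \<noteq> t" using t(1) s(2) by metis
  then obtain z where z: "z \<in> t" "z \<notin> s" using t(2) by blast
  obtain w where w: "w \<in> components_on E (t - {a})" "z \<in> w"
    using obtain_component[of z "t - {a}"] z a by blast
  have wt: "w \<in> tubes E" "w \<subseteq> t - {a}" using w component_tube component_subset by blast+
  have "tubing E (insert w T)"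
  proof (rule tubing_insert[OF T wt(1)])
    fix q assume "q \<in> T"
    then show "compatible E w q"
      using component_delete_compatible[OF T t(1) _ a(2) w(1)] a(1) t(2) by blast
  qed
  moreover have "crossing w s"
  proof -
    obtain x where "x \<in> w" "E x a" using component_delete_edge[OF tt _ w(1)] a t by blast
    then have "w \<union> s \<in> tubes E" using tube_Un[OF wt(1) s(1)] a by blast
    then show ?thesis using wt s z w a by (auto simp: crossing_def)
  qed
  ultimately show ?thesis by (rule that)
qed

text \<open>For each tube outside \<open>T\<close> some point keeps \<open>T\<close> tight and that
  tube slack; averaging these points makes all those tubes slack at once.\<close>

lemma tubing_exact_point:
  assumes strict: "\<And>a b. crossing a b \<Longrightarrow> gap f a b > 0" and T: "tubing E T"
  obtains x where "\<And>t. t \<in> tubes E \<Longrightarrow> sum x t \<le> f t"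
    "\<And>t. t \<in> tubes E \<Longrightarrow> sum x t = f t \<longleftrightarrow> t \<in> T"
proof -
  have sub: "\<And>a b. crossing a b \<Longrightarrow> gap f a b \<ge> 0" using strict by fastforce
  have "\<exists>x. (\<forall>t\<in>tubes E. sum x t \<le> f t) \<and> (\<forall>t\<in>T. sum x t = f t) \<and> (s \<notin> T \<longrightarrow> sum x s < f s)"
    if s: "s \<in> tubes E" for s
  proof (cases "s \<in> T")
    case True
    obtain x where "\<And>t. t \<in> tubes E \<Longrightarrow> sum x t \<le> f t" "\<And>t. t \<in> T \<Longrightarrow> sum x t = f t"
      using tubing_point[OF sub T] by blast
    then show ?thesis using True by blast
  next
    case False
    obtain w where w: "tubing E (insert w T)" "crossing w s"
      using exists_crossing_extension[OF T s False] by blast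
    obtain x where x: "\<And>t. t \<in> tubes E \<Longrightarrow> sum x t \<le> f t"
        "\<And>t. t \<in> insert w T \<Longrightarrow> sum x t = f t"
      using tubing_point[OF sub w(1)] by blast
    have "sum x s < f s"
      using crossing_not_tight[of x f w s, OF x(1) w(2) strict[OF w(2)]] x(2) by blast
    then show ?thesis using x by blast
  qed
  then obtain X where X: "\<And>s t. s \<in> tubes E \<Longrightarrow> t \<in> tubes E \<Longrightarrow> sum (X s) t \<le> f t"
     "\<And>s t. s \<in> tubes E \<Longrightarrow> t \<in> T \<Longrightarrow> sum (X s) t = f t"
     "\<And>s. s \<in> tubes E \<Longrightarrow> s \<notin> T \<Longrightarrow> sum (X s) s < f s" by metis
  define N where "N = real (card (tubes E))"
  have "tubes E \<noteq> {}" using singleton_tube[of undefined E] by blast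
  then have N: "N > 0" by (simp add: N_def card_gt_0_iff)
  define x where "x v = (\<Sum>s\<in>tubes E. X s v) / N" for v
  have sx: "N * sum x t = (\<Sum>s\<in>tubes E. sum (X s) t)" for t
    using N by (simp add: x_def sum_divide_distrib[symmetric] sum.swap[of _ "tubes E"])
  have c: "(\<Sum>s\<in>tubes E. f t) = N * f t" for t by (simp add: N_def)
  have le: "sum x t \<le> f t" if "t \<in> tubes E" for t
  proof -
    have "N * sum x t \<le> N * f t" unfolding sx c[symmetric] using X(1) that by (intro sum_mono)
    then show ?thesis using N by simp
  qed
  moreover have "sum x t = f t \<longleftrightarrow> t \<in> T" if t: "t \<in> tubes E" for t
  proof
    assume "t \<in> T"
    then have "N * sum x t = N * f t" unfolding sx c[symmetric] using X(2) by (intro sum.cong) auto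
    then show "sum x t = f t" using N by simp
  next
    assume eq: "sum x t = f t"
    show "t \<in> T"
    proof (rule ccontr)
      assume "t \<notin> T"
      then have "N * sum x t < N * f t" unfolding sx c[symmetric] using X(1,3) t
        by (intro sum_strict_mono_ex1) auto
      then show False using eq by simp
    qed
  qed
  ultimately show ?thesis using that by blast
qed

end

subsection \<open>The closure of the type cone\<close>

lemma orth_proj_props:
  assumes "subspace S"
  shows "orth_proj S x \<in> S" and "z \<in> S \<Longrightarrow> orth_proj S x \<bullet> z = x \<bullet> z"
  using theI'[OF orth_proj_unique[OF assms, of x]]
  by (auto simp: orth_proj_def orthogonal_def inner_diff_left)

context undirected_graph
begin

section \<open>The g-vectors and their rays\<close>

lemma gvec_ambient: "gvec E t \<in> ambient E"
  unfolding gvec_def by (rule orth_proj_props[OF subspace_ambient])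

lemma gvec_inner: "x \<in> ambient E \<Longrightarrow> gvec E t \<bullet> x = sum (($) x) t"
  unfolding gvec_def orth_proj_props(2)[OF subspace_ambient]
  by (simp add: inner_sum_left inner_axis')

lemma gvec_component: "K \<in> components_on E UNIV \<Longrightarrow> gvec E K = 0"
  using gvec_inner[OF gvec_ambient, of K K] gvec_ambient[of K] by (simp add: ambient_def)

lemma sum_axis_diff:
  "sum (($) (axis p 1 - axis q 1 :: real ^ 'v)) t = of_bool (p \<in> t) - of_bool (q \<in> t)"
  by (simp add: axis_def sum_subtractf)

lemma axis_diff_ambient:
  assumes "K \<in> components_on E UNIV" "p \<in> K" "q \<in> K"
  shows "axis p 1 - axis q 1 \<in> ambient E"
proof -
  have "p \<in> L \<longleftrightarrow> q \<in> L" if "L \<in> components_on E UNIV" for L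
    using component_eqI[OF assms(1) that] assms by blast
  then have "sum (($) (axis p 1 - axis q 1 :: real ^ 'v)) L = 0" if "L \<in> components_on E UNIV" for L
    using that unfolding sum_axis_diff by auto
  then show ?thesis by (simp add: ambient_def)
qed

lemma proper_tube_component:
  assumes "t \<in> tubes E" "t \<notin> components_on E UNIV"
  obtains K where "K \<in> components_on E UNIV" "t \<subset> K"
proof -
  obtain p where p: "p \<in> t" using assms tube_nonempty by blast
  obtain K where K: "K \<in> components_on E UNIV" "p \<in> K" using obtain_component[of p UNIV] by blast
  have "t \<subseteq> K" using tube_in_component[OF K(1) assms(1)] p K by blast
  moreover have "t \<noteq> K" using K assms by metis
  ultimately show ?thesis using that K by blast
qed

text \<open>Testing with \<open>axis p 1 - axis q 1\<close>, for \<open>p\<close> in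
  \<open>s\<close> and \<open>q\<close> in \<open>K - s\<close>, gives 1 on the left; a nonnegative
  multiple matches this only if \<open>t\<close> contains \<open>p\<close> and not \<open>q\<close>.
  This also excludes the factor 0, as \<open>gvec_nonzero\<close> exploits.\<close>

lemma gvec_parallel:
  assumes s: "s \<in> tubes E" "s \<notin> components_on E UNIV" and t: "t \<in> tubes E"
    and c: "gvec E s = c *\<^sub>R gvec E t" "c \<ge> 0"
  shows "s = t"
proof -
  obtain K where K: "K \<in> components_on E UNIV" "s \<subset> K" using proper_tube_component[OF s] .
  have pq: "p \<in> t \<and> q \<notin> t" if "p \<in> s" "q \<in> K - s" for p q
  proof -
    let ?y = "axis p 1 - axis q 1 :: real ^ 'v"
    have y: "?y \<in> ambient E" using axis_diff_ambient[OF K(1)] that K by blast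
    have "sum (($) ?y) s = c * sum (($) ?y) t"
      using gvec_inner[OF y, of s] gvec_inner[OF y, of t] c by simp
    then have "1 = c * (of_bool (p \<in> t) - of_bool (q \<in> t))"
      using that unfolding sum_axis_diff by simp
    then show ?thesis using c(2) by (cases "p \<in> t"; cases "q \<in> t") auto
  qed
  obtain p q where "p \<in> s" "q \<in> K - s" using K s tube_nonempty by blast
  then have "s \<subseteq> t" "t \<inter> (K - s) = {}" using pq by blast+
  moreover have "t \<subseteq> K"
    using tube_in_component[OF K(1) t] \<open>s \<subseteq> t\<close> \<open>p \<in> s\<close> K by blast
  ultimately show ?thesis by blast
qed

lemma gvec_nonzero:
  assumes "s \<in> tubes E" "s \<notin> components_on E UNIV" shows "gvec E s \<noteq> 0"
proof
  assume z: "gvec E s = 0"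
  obtain K where K: "K \<in> components_on E UNIV" "s \<subset> K" using proper_tube_component[OF assms] .
  then obtain p where p: "p \<in> K" "p \<notin> s" by blast
  have "s = {p}" by (rule gvec_parallel[OF assms singleton_tube, of 0]) (use z in auto)
  then show False using p by simp
qed

section \<open>Heights with positive gaps lie in the type cone\<close>

definition heights :: "(real ^ ('v set)) set" where
  "heights = {h. (\<forall>s. s \<notin> tubes E \<longrightarrow> h $ s = 0) \<and> (\<forall>K\<in>components_on E UNIV. h $ K = 0)}"

lemma subspace_heights: "subspace heights"
  by (auto simp: subspace_def heights_def)

lemma linear_gap: "linear (\<lambda>h :: real ^ ('v set). gap (($) h) a b)"
  by (rule linearI) (simp_all add: gap_def csum_def sum.distrib sum_distrib_left algebra_simps)

lemma deformation_le: "x \<in> deformation E h \<Longrightarrow> t \<in> tubes E \<Longrightarrow> sum (($) x) t \<le> h $ t"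
  by (auto simp: deformation_def gvec_inner)

lemma convex_deformation: "convex (deformation E h)"
proof -
  have "deformation E h = ambient E \<inter> (\<Inter>t\<in>tubes E. {x. gvec E t \<bullet> x \<le> h $ t})"
    by (auto simp: deformation_def)
  then show ?thesis
    by (simp add: convex_Int convex_INT convex_halfspace_le subspace_imp_convex[OF subspace_ambient])
qed

lemma normal_cone_deformation:
  assumes "x \<in> deformation E h"
  shows "normal_cone (ambient E) (deformation E h) {x} =
    convex_cone hull (gvec E ` {t \<in> tubes E. sum (($) x) t = h $ t})"
proof -
  have xa: "x \<in> ambient E" using assms by (simp add: deformation_def)
  show ?thesis
    using normal_cone_singleton_eq[OF subspace_ambient _ _ deformation_def assms] gvec_ambient
    by (simp add: gvec_inner[OF xa] cong: conj_cong)
qed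

lemma strict_height_in_type_cone:
  assumes h: "h \<in> heights" and strict: "\<And>a b. crossing a b \<Longrightarrow> gap (($) h) a b > 0"
  shows "h \<in> type_cone E"
proof -
  let ?P = "deformation E h" and ?H = "ambient E"
  have "normal_fan ?H ?P = nested_fan E"
  proof (intro equalityI subsetI)
    fix N assume "N \<in> normal_fan ?H ?P"
    then obtain F where F: "F face_of ?P" "F \<noteq> {}" "N = normal_cone ?H ?P F"
      by (auto simp: normal_fan_def)
    obtain x where x: "x \<in> F" "N = normal_cone ?H ?P {x}"
      using normal_cone_face_singleton[OF convex_deformation F(1,2)] F(3) by metis
    have xP: "x \<in> ?P" using x F face_of_imp_subset by blast
    let ?T = "{t \<in> tubes E. sum (($) x) t = h $ t}"
    have "components_on E UNIV \<subseteq> ?T"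
      using xP h component_tube by (auto simp: heights_def deformation_def ambient_def)
    moreover have "compatible E s t" if st: "s \<in> ?T" "t \<in> ?T" for s t
    proof (rule ccontr)
      assume "\<not> compatible E s t"
      then have cr: "crossing s t" using st crossing_iff by blast
      have "sum (($) x) t < h $ t"
        by (rule crossing_not_tight[OF deformation_le[OF xP] cr strict[OF cr]]) (use st in auto)
      then show False using st by simp
    qed
    ultimately have "tubing E ?T" by (auto simp: tubing_def)
    then show "N \<in> nested_fan E"
      unfolding nested_fan_def x(2) normal_cone_deformation[OF xP] by blast
  next
    fix N assume "N \<in> nested_fan E"
    then obtain T where T: "tubing E T" "N = convex_cone hull (gvec E ` T)"
      by (auto simp: nested_fan_def)
    obtain y where y: "\<And>t. t \<in> tubes E \<Longrightarrow> sum y t \<le> h $ t"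
      "\<And>t. t \<in> tubes E \<Longrightarrow> sum y t = h $ t \<longleftrightarrow> t \<in> T"
      using tubing_exact_point[OF strict T(1)] by blast
    define x :: "real ^ 'v" where "x = (\<chi> v. y v)"
    have sx: "sum (($) x) t = sum y t" for t by (simp add: x_def)
    have "sum y K = 0" if "K \<in> components_on E UNIV" for K
      using y(2)[of K] that component_tube tubing_component[OF T(1) that] h by (auto simp: heights_def)
    then have xa: "x \<in> ?H" by (simp add: ambient_def sx)
    then have xP: "x \<in> ?P" using y(1) by (simp add: deformation_def gvec_inner sx)
    have "{t \<in> tubes E. sum (($) x) t = h $ t} = T"
      using y(2) tubing_tube[OF T(1)] by (auto simp: sx)
    then have N: "N = normal_cone ?H ?P {x}" using normal_cone_deformation[OF xP] T(2) by simp
    \<comment> \<open>The face where all of \<open>T\<close> is tight has the same normal cone as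
      \<open>x\<close>: the generators of \<open>N\<close> are maximal on the whole face, and
      \<open>x\<close> belongs to it.\<close>
    let ?F = "{z \<in> ?P. \<forall>t\<in>T. gvec E t \<bullet> z = h $ t}"
    have le: "gvec E t \<bullet> z \<le> h $ t" if "t \<in> T" "z \<in> ?P" for t z
      using that tubing_tube[OF T(1)] by (auto simp: deformation_def)
    have F: "?F face_of ?P" using tight_face_of[OF convex_deformation, of T] le by blast
    have xF: "x \<in> ?F" using xP y(2) tubing_tube[OF T(1)] by (auto simp: gvec_inner[OF xa] sx)
    have "N \<subseteq> normal_cone ?H ?P ?F"
      unfolding T(2)
    proof (rule hull_minimal)
      show "gvec E ` T \<subseteq> normal_cone ?H ?P ?F"
        using le gvec_ambient by (auto simp: normal_cone_def)
    qed (rule convex_cone_normal_cone[OF subspace_ambient])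
    moreover have "normal_cone ?H ?P ?F \<subseteq> N"
      unfolding N normal_cone_def using xF by blast
    ultimately have "N = normal_cone ?H ?P ?F" by blast
    then show "N \<in> normal_fan ?H ?P" unfolding normal_fan_def using F xF by blast
  qed
  then show ?thesis using h by (simp add: type_cone_def heights_def)
qed

section \<open>Gaps of heights in the type cone\<close>

lemma compatible_component:
  assumes "K \<in> components_on E UNIV" "t \<in> tubes E" shows "compatible E t K"
proof (rule ccontr)
  assume no: "\<not> compatible E t K"
  then have "t \<union> K \<in> tubes E"
    using crossing_iff[of t K] assms component_tube crossing_def by blast
  moreover have "(t \<union> K) \<inter> K \<noteq> {}"
    using tube_nonempty[OF component_tube[OF assms(1)]] by blast
  ultimately have "t \<subseteq> K" using tube_in_component[OF assms(1), of "t \<union> K"] by simp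
  then show False using no by (auto simp: compatible_def)
qed

lemma type_cone_face:
  assumes "h \<in> type_cone E" "tubing E T"
  obtains x where "x \<in> deformation E h"
    "normal_cone (ambient E) (deformation E h) {x} = convex_cone hull (gvec E ` T)"
proof -
  have "convex_cone hull (gvec E ` T) \<in> normal_fan (ambient E) (deformation E h)"
    using assms by (auto simp: type_cone_def nested_fan_def)
  then obtain F where F: "F face_of deformation E h" "F \<noteq> {}"
    "convex_cone hull (gvec E ` T) = normal_cone (ambient E) (deformation E h) F"
    by (auto simp: normal_fan_def)
  obtain x where "x \<in> F" "normal_cone (ambient E) (deformation E h) F =
      normal_cone (ambient E) (deformation E h) {x}"
    using normal_cone_face_singleton[OF convex_deformation F(1,2)] by blast
  then show ?thesis using that F face_of_imp_subset by blast
qed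

text \<open>The cone of the tubing made of \<open>t\<close> and the graph components is the ray of
  \<open>gvec E t\<close>. If \<open>t\<close> were slack at the point of this cone, then by
  \<open>gvec_parallel\<close> no tight tube could have a nonzero vector on the ray, and the cone
  would collapse to 0.\<close>

lemma type_cone_attained:
  assumes h: "h \<in> type_cone E" and t: "t \<in> tubes E"
  obtains x where "x \<in> deformation E h" "sum (($) x) t = h $ t"
proof -
  let ?T = "insert t (components_on E UNIV)"
  have T: "tubing E ?T"
    by (rule tubing_insert[OF tubing_components t]) (rule compatible_component[OF _ t])
  obtain x where x: "x \<in> deformation E h"
    "normal_cone (ambient E) (deformation E h) {x} = convex_cone hull (gvec E ` ?T)"
    using type_cone_face[OF h T] .
  let ?A = "{s \<in> tubes E. sum (($) x) s = h $ s}"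
  have A: "convex_cone hull (gvec E ` ?A) = convex_cone hull (gvec E ` ?T)"
    using x normal_cone_deformation by metis
  have "t \<in> ?A"
  proof (cases "t \<in> components_on E UNIV")
    case True
    then show ?thesis using t h x(1) by (auto simp: type_cone_def deformation_def ambient_def)
  next
    case False
    show ?thesis
    proof (rule ccontr)
      assume tA: "t \<notin> ?A"
      have ray: "convex_cone hull (gvec E ` ?T) \<subseteq> {c *\<^sub>R gvec E t | c. c \<ge> 0}"
      proof (rule hull_minimal)
        show "gvec E ` ?T \<subseteq> {c *\<^sub>R gvec E t | c. c \<ge> 0}"
        proof
          fix g assume "g \<in> gvec E ` ?T"
          then have "g = 1 *\<^sub>R gvec E t \<or> g = 0 *\<^sub>R gvec E t" using gvec_component by auto
          then show "g \<in> {c *\<^sub>R gvec E t | c. c \<ge> 0}"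
            by (metis (mono_tags, lifting) mem_Collect_eq order_refl zero_le_one)
        qed
        have "convex_cone ((\<lambda>c. c *\<^sub>R gvec E t) ` {0..})"
          by (intro convex_cone_linear_image) (auto simp: convex_cone_iff intro: linearI scaleR_add_left)
        moreover have "(\<lambda>c. c *\<^sub>R gvec E t) ` {0..} = {c *\<^sub>R gvec E t | c. c \<ge> 0}" by auto
        ultimately show "convex_cone {c *\<^sub>R gvec E t | c. c \<ge> 0}" by simp
      qed
      have "gvec E s = 0" if s: "s \<in> ?A" for s
      proof -
        have "gvec E s \<in> convex_cone hull (gvec E ` ?A)" using s by (intro hull_inc) blast
        then obtain c where "gvec E s = c *\<^sub>R gvec E t" "c \<ge> 0" using A ray by auto
        then have "s \<in> components_on E UNIV" using gvec_parallel[of s t c] s t tA by blast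
        then show ?thesis by (rule gvec_component)
      qed
      then have "convex_cone hull (gvec E ` ?A) \<subseteq> {0}"
        by (intro hull_minimal) (auto simp: convex_cone_singleton)
      moreover have "gvec E t \<in> convex_cone hull (gvec E ` ?T)" by (intro hull_inc) blast
      ultimately show False using A gvec_nonzero[OF t False] by auto
    qed
  qed
  then show ?thesis using that x(1) by blast
qed

text \<open>Vectors of the normal cone at \<open>x\<close> attain their maximum there, and the
  maximum of \<open>gvec E t\<close> is \<open>h $ t\<close> by
  \<open>type_cone_attained\<close>.\<close>

lemma type_cone_tight:
  assumes h: "h \<in> type_cone E" and T: "tubing E T"
  obtains x where "x \<in> deformation E h" "\<And>t. t \<in> T \<Longrightarrow> sum (($) x) t = h $ t"
proof -
  obtain x where x: "x \<in> deformation E h"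
    "normal_cone (ambient E) (deformation E h) {x} = convex_cone hull (gvec E ` T)"
    using type_cone_face[OF h T] .
  have "sum (($) x) t = h $ t" if t: "t \<in> T" for t
  proof -
    have tt: "t \<in> tubes E" using tubing_tube[OF T t] .
    obtain y where y: "y \<in> deformation E h" "sum (($) y) t = h $ t"
      using type_cone_attained[OF h tt] .
    have "gvec E t \<in> normal_cone (ambient E) (deformation E h) {x}"
      unfolding x(2) using t by (intro hull_inc) blast
    then have "gvec E t \<bullet> y \<le> gvec E t \<bullet> x" using y by (auto simp: normal_cone_def)
    then have "h $ t \<le> sum (($) x) t"
      using x(1) y by (simp add: gvec_inner deformation_def)
    then show ?thesis using deformation_le[OF x(1) tt] by simp
  qed
  then show ?thesis using that x(1) by blast
qed

lemma type_cone_gap_nonneg: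
  assumes h: "h \<in> type_cone E" and cr: "crossing a b"
  shows "gap (($) h) a b \<ge> 0"
proof -
  let ?K = "components_on E (a \<inter> b)" and ?C = "components_on E UNIV"
  let ?T = "insert (a \<union> b) (?K \<union> ?C)"
  have ab: "a \<in> tubes E" "b \<in> tubes E" "a \<union> b \<in> tubes E" using cr by (auto simp: crossing_def)
  have "tubing E (?K \<union> ?C)"
    unfolding tubing_def
    using component_tube components_compatible compatible_component compatible_sym by blast
  then have T: "tubing E ?T"
  proof (rule tubing_insert[OF _ ab(3)])
    fix s assume s: "s \<in> ?K \<union> ?C"
    show "compatible E (a \<union> b) s"
    proof (cases "s \<in> ?K")
      case True
      then show ?thesis using component_subset by (fastforce simp: compatible_def)
    next
      case False
      then show ?thesis using s compatible_component ab by blast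
    qed
  qed
  obtain x where x: "x \<in> deformation E h" "\<And>t. t \<in> ?T \<Longrightarrow> sum (($) x) t = h $ t"
    using type_cone_tight[OF h T] by blast
  have "csum (($) h) (a \<inter> b) = csum (sum (($) x)) (a \<inter> b)"
    unfolding csum_def by (rule sum.cong) (use x(2) in auto)
  then have "h $ (a \<union> b) + csum (($) h) (a \<inter> b) = sum (($) x) (a \<union> b) + sum (($) x) (a \<inter> b)"
    using x(2)[of "a \<union> b"] by (simp add: csum_sum)
  also have "\<dots> = sum (($) x) a + sum (($) x) b" by (simp add: sum.union_inter)
  also have "\<dots> \<le> h $ a + h $ b"
    using deformation_le[OF x(1)] ab by (simp add: add_mono)
  finally show ?thesis by (simp add: gap_def)
qed

text \<open>Subtracting a modular function leaves every gap unchanged, so that the values on the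
  connected components of the graph can be normalised to zero.\<close>

lemma exists_height_with_gaps:
  obtains h where "h \<in> heights" "\<And>a b. crossing a b \<Longrightarrow> gap (($) h) a b = gap f a b"
proof -
  have "\<forall>v. \<exists>K. K \<in> components_on E UNIV \<and> v \<in> K" using obtain_component by (metis UNIV_I)
  then obtain K where K: "\<And>v. K v \<in> components_on E UNIV" "\<And>v. v \<in> K v" by metis
  \<comment> \<open>Spreads the value of \<open>f\<close> on a graph component evenly over its
    vertices, so that \<open>sum c\<close> agrees with \<open>f\<close> there.\<close>
  define c where "c v = f (K v) / real (card (K v))" for v
  have c: "sum c L = f L" if L: "L \<in> components_on E UNIV" for L
  proof -
    have "K v = L" if "v \<in> L" for v using component_eqI[OF K(1) L] K(2) that by blast
    then have "sum c L = (\<Sum>v\<in>L. f L / real (card L))" unfolding c_def by (intro sum.cong) auto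
    moreover have "card L \<noteq> 0" using component_tube[OF L] tube_nonempty by (simp add: card_eq_0_iff)
    ultimately show ?thesis by simp
  qed
  define h :: "real ^ ('v set)" where "h = (\<chi> s. if s \<in> tubes E then f s - sum c s else 0)"
  have ht: "h $ s = f s - sum c s" if "s \<in> tubes E" for s using that by (simp add: h_def)
  have hc: "csum (($) h) U = csum f U - sum c U" for U
  proof -
    have "csum (($) h) U = (\<Sum>s\<in>components_on E U. f s - sum c s)"
      unfolding csum_def using ht component_tube by (intro sum.cong) auto
    then show ?thesis using csum_sum[of c U] by (simp add: csum_def sum_subtractf)
  qed
  have "h \<in> heights" using c ht component_tube by (auto simp: heights_def h_def)
  moreover have "gap (($) h) a b = gap f a b" if "crossing a b" for a b
    using that sum.union_inter[of a b c] by (simp add: gap_def crossing_def ht hc)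
  ultimately show ?thesis using that by blast
qed

section \<open>The closure as a polyhedral cone\<close>

lemma crossing_card:
  assumes "crossing a b"
  shows "card a < card (a \<union> b)" "card b < card (a \<union> b)"
  using assms by (auto simp: crossing_def intro!: psubset_card_mono)

definition height_cone :: "(real ^ ('v set)) set" where
  "height_cone = {h \<in> heights. \<forall>a b. crossing a b \<longrightarrow> gap (($) h) a b \<ge> 0}"

lemma exists_strict_height:
  obtains c where "c \<in> heights" "\<And>a b. crossing a b \<Longrightarrow> gap (($) c) a b > 0"
proof -
  \<comment> \<open>The union of crossing tubes has more vertices than either, so base 3 gives
    \<open>3 ^ card a + 3 ^ card b \<le> 2/3 * 3 ^ card (a \<union> b)\<close>; the intersection
    term only enlarges the gap.\<close>
  define f :: "'v set \<Rightarrow> real" where "f s = - (3 ^ card s)" for s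
  have "gap f a b > 0" if ab: "crossing a b" for a b
  proof -
    have "(3::real) ^ Suc (card a) \<le> 3 ^ card (a \<union> b)" "(3::real) ^ Suc (card b) \<le> 3 ^ card (a \<union> b)"
      using crossing_card[OF ab] by (auto simp del: power_Suc intro!: power_increasing)
    moreover have "csum f (a \<inter> b) \<le> 0" unfolding csum_def f_def by (intro sum_nonpos) auto
    moreover have "(3::real) ^ card (a \<union> b) > 0" by simp
    ultimately show ?thesis unfolding gap_def f_def power_Suc by linarith
  qed
  then show ?thesis using exists_height_with_gaps[of f] that by metis
qed

text \<open>Nonnegativity of the gaps is a closed condition that holds on the type cone. Conversely,
  adding small multiples of a height with positive gaps gives members of the type cone converging to
  \<open>h\<close>.\<close>

lemma closure_type_cone: "closure (type_cone E) = height_cone"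
proof
  have "height_cone = heights \<inter> (\<Inter>a. \<Inter>b\<in>{b. crossing a b}. {h. 0 \<le> gap (($) h) a b})"
    by (auto simp: height_cone_def)
  moreover have "closed {h :: real ^ ('v set). 0 \<le> gap (($) h) a b}" for a b
    using linear_continuous_on[OF linear_conv_bounded_linear[THEN iffD1, OF linear_gap]]
    by (intro closed_Collect_le) auto
  ultimately have "closed height_cone"
    by (auto intro!: closed_Int closed_INT closed_subspace[OF subspace_heights])
  moreover have "type_cone E \<subseteq> height_cone"
    using type_cone_gap_nonneg by (auto simp: height_cone_def type_cone_def heights_def)
  ultimately show "closure (type_cone E) \<subseteq> height_cone" by (rule closure_minimal[rotated])
  show "height_cone \<subseteq> closure (type_cone E)"
  proof
    fix h assume h: "h \<in> height_cone"
    obtain c where c: "c \<in> heights" "\<And>a b. crossing a b \<Longrightarrow> gap (($) c) a b > 0"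
      using exists_strict_height by blast
    let ?s = "\<lambda>n. h + inverse (real (Suc n)) *\<^sub>R c"
    have "?s n \<in> type_cone E" for n
    proof (rule strict_height_in_type_cone)
      show "?s n \<in> heights" using h c subspace_heights
        by (auto simp: height_cone_def intro!: subspace_add subspace_scale)
      show "gap (($) (?s n)) a b > 0" if "crossing a b" for a b
        using h c(2)[OF that] that
        unfolding linear_add[OF linear_gap] linear_scale[OF linear_gap]
        by (auto simp: height_cone_def intro!: add_nonneg_pos)
    qed
    moreover have "?s \<longlonglongrightarrow> h + 0 *\<^sub>R c"
      by (intro tendsto_intros LIMSEQ_inverse_real_of_nat)
    then have "?s \<longlonglongrightarrow> h" by simp
    ultimately show "h \<in> closure (type_cone E)" 
      unfolding closure_sequential by (intro exI[of _ ?s]) simp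
  qed
qed

subsection \<open>Exchangeable pairs\<close>

lemma maximal_tubing_mem:
  assumes "maximal_tubing E T" "w \<in> tubes E" "\<And>s. s \<in> T \<Longrightarrow> compatible E w s"
  shows "w \<in> T"
proof -
  have "tubing E (insert w T)" using assms by (intro tubing_insert) (auto simp: maximal_tubing_def)
  then have "insert w T = T" using assms(1) unfolding maximal_tubing_def by blast
  then show ?thesis by blast
qed

text \<open>Otherwise the component of \<open>q - {a}\<close> containing \<open>b\<close> is
  compatible with all of \<open>T\<close>, hence by maximality a smaller tube of \<open>T\<close>
  around \<open>b\<close>.\<close>

lemma own_vertex_unique:
  assumes T: "maximal_tubing E T" and q: "q \<in> T"
    and a: "a \<in> q" "\<And>c. c \<in> T \<Longrightarrow> c \<subset> q \<Longrightarrow> a \<notin> c"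
    and b: "b \<in> q" "\<And>c. c \<in> T \<Longrightarrow> c \<subset> q \<Longrightarrow> b \<notin> c"
  shows "a = b"
proof (rule ccontr)
  assume "a \<noteq> b"
  have tub: "tubing E T" using T by (simp add: maximal_tubing_def)
  obtain w where w: "w \<in> components_on E (q - {a})" "b \<in> w"
    using obtain_component[of b "q - {a}"] b(1) \<open>a \<noteq> b\<close> by blast
  have "w \<in> T"
    using maximal_tubing_mem[OF T component_tube[OF w(1)]]
      component_delete_compatible[OF tub q a w(1)] by blast
  moreover have "w \<subset> q" using component_subset[OF w(1)] a(1) by blast
  ultimately show False using b(2) w(2) by blast
qed

lemma exchangeable_sym: "exchangeable E t t' \<Longrightarrow> exchangeable E t' t"
  unfolding exchangeable_def by metis

lemma crossing_gateway:
  assumes "crossing a b"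
  shows "\<exists>y\<in>a - b. \<exists>w\<in>b. E y w"
proof (cases "a \<inter> b = {}")
  case True
  then show ?thesis using tube_edge[of a b] assms by (auto simp: crossing_def)
next
  case False
  then show ?thesis
    using tube_cut[of a E "a \<inter> b"] assms edge_sym by (force simp: crossing_def)
qed

text \<open>The union \<open>U\<close> of the pair belongs to both tubings. By maximality
  \<open>v\<close> is its only vertex in no smaller tube of \<open>T'\<close>, and every vertex of
  \<open>t - t'\<close> adjacent to \<open>t'\<close> has this property too.\<close>

lemma exchangeable_gateway:
  assumes "exchangeable E t t'"
  obtains v where "crossing t t'" "v \<in> t - t'" "\<exists>w\<in>t'. E v w"
    "\<forall>y\<in>t - t'. \<forall>w\<in>t'. E y w \<longrightarrow> y = v"
proof -
  obtain T T' where tt: "t \<noteq> t'" and T: "maximal_tubing E T" "t \<in> T"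
    and T': "maximal_tubing E T'" "t' \<in> T'" and R: "T - {t} = T' - {t'}"
    using assms unfolding exchangeable_def by blast
  have tub: "tubing E T" "tubing E T'" using T T' by (auto simp: maximal_tubing_def)
  have tubes: "t \<in> tubes E" "t' \<in> tubes E" using tubing_tube tub T T' by blast+
  have qR: "q = t \<or> q \<in> T'" if "q \<in> T" for q using R that by blast
  have "t' \<notin> T" using R tt by blast
  have cr: "crossing t t'"
  proof (rule ccontr)
    assume "\<not> crossing t t'"
    then have "compatible E t' t" using crossing_iff tubes compatible_sym by blast
    then have "compatible E t' s" if "s \<in> T" for s
      using qR[OF that] tubing_compatible[OF tub(2) T'(2)] by blast
    then show False using maximal_tubing_mem[OF T(1) tubes(2)] \<open>t' \<notin> T\<close> by blast
  qed
  define U where "U = t \<union> t'"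
  have U: "U \<in> tubes E" "t \<subset> U" "t' \<subset> U" using cr by (auto simp: crossing_def U_def)
  have "compatible E U q" if q: "q \<in> T" for q
  proof (cases "q = t")
    case True
    then show ?thesis using U by (auto simp: compatible_def)
  next
    case False
    have qt: "q \<in> tubes E" using tubing_tube[OF tub(1) q] .
    have c: "compatible E q t" "compatible E q t'"
      using tubing_compatible[OF tub(1) q T(2)] tubing_compatible[OF tub(2) _ T'(2)] qR[OF q] False
      by blast+
    show ?thesis
    proof (rule ccontr)
      assume "\<not> compatible E U q"
      then have "crossing U q" using crossing_iff U qt by blast
      then have n: "\<not> U \<subseteq> q" "\<not> q \<subseteq> U" "U \<union> q \<in> tubes E" by (auto simp: crossing_def)
      obtain x y where xy: "x \<in> U" "y \<in> q" "x = y \<or> E x y"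
        using tube_edge[OF U(1) qt n(3)] by (cases "U \<inter> q = {}") blast+
      \<comment> \<open>The tube \<open>q\<close> touches \<open>s\<close>, so it is nested with
        \<open>s\<close>; not lying in \<open>U\<close>, it contains \<open>s\<close>. As
        \<open>t\<close> and \<open>t'\<close> touch each other, the same argument gives the other
        one.\<close>
      have step: "t \<subseteq> q \<and> t' \<subseteq> q" if "s \<in> {t, t'}" "x \<in> s" for s
      proof -
        have "s \<subseteq> q"
          using compatible_edge[of q s y x] c xy qt tubes that edge_sym n(2) U by blast
        obtain p p' where pp: "p \<in> t" "p' \<in> t'" "p = p' \<or> E p p'"
          using tube_edge[of t t'] cr unfolding crossing_def by blast
        show ?thesis
        proof (cases "s = t")
          case True
          then have "t' \<subseteq> q"
            using compatible_edge[of q t' p p'] c qt tubes pp \<open>s \<subseteq> q\<close> n(2) U by blast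
          then show ?thesis using True \<open>s \<subseteq> q\<close> by blast
        next
          case False
          then have "s = t'" using that by blast
          then have "t \<subseteq> q"
            using compatible_edge[of q t p' p] c qt tubes pp edge_sym \<open>s \<subseteq> q\<close> n(2) U by blast
          then show ?thesis using \<open>s = t'\<close> \<open>s \<subseteq> q\<close> by blast
        qed
      qed
      have "U \<subseteq> q" using step[of t] step[of t'] xy(1) unfolding U_def by blast
      then show False using n by blast
    qed
  qed
  then have UT: "U \<in> T" using maximal_tubing_mem[OF T(1) U(1)] by blast
  then have UT': "U \<in> T'" using qR U by blast
  obtain v where v: "v \<in> U" "\<And>c. c \<in> T' \<Longrightarrow> c \<subset> U \<Longrightarrow> v \<notin> c"
    using exists_own_vertex[OF tub(2) U(1), of U] by blast
  then have vt: "v \<in> t - t'" using T' U by (auto simp: U_def)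
  have uniq: "y = v" if y: "y \<in> t - t'" "w \<in> t'" "E y w" for y w
  proof (rule own_vertex_unique[OF T'(1) UT' _ _ v])
    show "y \<in> U" using y by (simp add: U_def)
    fix c assume c: "c \<in> T'" "c \<subset> U"
    \<comment> \<open>A smaller tube \<open>c\<close> around \<open>y\<close> touches
      \<open>t'\<close> and therefore contains it. It is also nested with \<open>t\<close>, so it
      would contain \<open>U\<close> or force \<open>t' \<subseteq> t\<close>.\<close>
    show "y \<notin> c"
    proof
      assume "y \<in> c"
      then have "c \<in> T" using R c(1) y by blast
      have ct: "c \<in> tubes E" using tubing_tube[OF tub(2) c(1)] .
      have "t' \<subseteq> c"
        using compatible_edge[OF tubing_compatible[OF tub(2) c(1) T'(2)] ct tubes(2) \<open>y \<in> c\<close> y(2)] y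
          \<open>y \<in> c\<close> by blast
      moreover have "t \<subseteq> c \<or> c \<subseteq> t"
        using compatible_edge[OF tubing_compatible[OF tub(1) T(2) \<open>c \<in> T\<close>] tubes(1) ct _ \<open>y \<in> c\<close>] y
        by blast
      ultimately show False using c(2) cr by (auto simp: U_def crossing_def)
    qed
  qed
  obtain y w where yw: "y \<in> t - t'" "w \<in> t'" "E y w" using crossing_gateway[OF cr] by blast
  have "E v w" using uniq[OF yw] yw(3) by simp
  then have "\<exists>w\<in>t'. E v w" using yw(2) by blast
  then show ?thesis using that[OF cr vt] uniq by blast
qed

text \<open>A maximal tube \<open>A\<close> with \<open>B \<subseteq> A \<subset> t\<close> misses
  just one vertex, since adding a neighbour in \<open>t\<close> gives a tube that must be all of
  \<open>t\<close>.\<close>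

lemma tube_remove_vertex:
  assumes "B \<in> tubes E" "t \<in> tubes E" "B \<subset> t"
  obtains w where "w \<in> t - B" "t - {w} \<in> tubes E"
proof -
  define D where "D = {A \<in> tubes E. B \<subseteq> A \<and> A \<subset> t}"
  have "B \<in> D" using assms by (simp add: D_def)
  then obtain A where AD: "A \<in> D" and max: "\<And>C. C \<in> D \<Longrightarrow> A \<subseteq> C \<Longrightarrow> A = C"
    using finite_has_maximal[OF finite, of D] by blast
  have A: "A \<in> tubes E" "B \<subseteq> A" "A \<subset> t" using AD by (auto simp: D_def)
  obtain x w where xw: "x \<in> A" "w \<in> t - A" "E x w"
    using tube_cut[OF assms(2), of A] A tube_nonempty by blast
  have "insert w A \<in> tubes E" using tube_insert A xw by blast
  moreover have "insert w A \<notin> D" using max[of "insert w A"] xw by blast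
  ultimately have "insert w A = t" using A xw by (auto simp: D_def)
  then have "t - {w} = A" using xw by blast
  then show ?thesis using that[of w] A xw by blast
qed

text \<open>As \<open>v\<close> is the only vertex of \<open>t - t'\<close> adjacent to
  \<open>t'\<close>, it alone links \<open>t \<inter> t'\<close> to the rest of \<open>t\<close>.
  Hence \<open>?B\<close> is a tube, and a vertex outside it can be removed.\<close>

lemma removable_vertex:
  assumes cr: "crossing t t'" and v: "v \<in> t - t'"
    and uniq: "\<forall>y\<in>t - t'. \<forall>w\<in>t'. E y w \<longrightarrow> y = v"
    and ne: "t - t' \<noteq> {v}"
  obtains w where "w \<in> t - t'" "w \<noteq> v" "t - {w} \<in> tubes E"
proof -
  let ?B = "insert v (t \<inter> t')"
  have t: "t \<in> tubes E" using cr by (simp add: crossing_def)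
  have "?B \<in> tubes E"
  proof (rule tubeI_cut)
    fix X assume X: "X \<subseteq> ?B" "X \<noteq> {}" "X \<noteq> ?B"
    show "\<exists>x\<in>X. \<exists>y\<in>?B - X. E x y"
    proof (rule ccontr)
      assume no: "\<not> ?thesis"
      \<comment> \<open>The side of the cut avoiding \<open>v\<close>. Its outgoing edge within
        \<open>t\<close> would end in a second vertex of \<open>t - t'\<close> adjacent to
        \<open>t'\<close>.\<close>
      define Y where "Y = (if v \<in> X then ?B - X else X)"
      have Y: "Y \<subseteq> t \<inter> t'" "Y \<noteq> {}" "\<And>x y. x \<in> Y \<Longrightarrow> y \<in> ?B - Y \<Longrightarrow> \<not> E x y"
        using X no edge_sym unfolding Y_def by (cases "v \<in> X"; simp; blast)+
      have "Y \<subseteq> t" "Y \<noteq> t" using Y(1) v by blast+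
      then obtain x y where xy: "x \<in> Y" "y \<in> t - Y" "E x y"
        using tube_cut[OF t, of Y] Y(2) by blast
      then have "y \<notin> ?B" using Y(3) by blast
      then show False using uniq xy Y(1) edge_sym by blast
    qed
  qed simp
  moreover have "?B \<subset> t" using v ne by blast
  ultimately obtain w where "w \<in> t - ?B" "t - {w} \<in> tubes E"
    using tube_remove_vertex[OF _ t] by blast
  then show ?thesis using that[of w] by blast
qed

subsection \<open>Facets\<close>

lemma csum_axis: "csum (($) (axis p 1 :: real ^ ('v set))) U = of_bool (p \<in> components_on E U)"
  by (simp add: csum_def axis_def)

lemma axis_heights:
  assumes "p \<in> tubes E" "p \<subset> q" "q \<in> tubes E"
  shows "axis p 1 \<in> heights"
proof -
  have "p \<notin> components_on E UNIV"
  proof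
    assume "p \<in> components_on E UNIV"
    then have "q \<subseteq> p" using tube_in_component[of p UNIV q] assms tube_nonempty by blast
    then show False using assms by blast
  qed
  then show ?thesis using assms(1) by (auto simp: heights_def axis_def)
qed

text \<open>\<open>Q\<close> marks the gaps that vanish at \<open>c\<close> and stay zero along
  \<open>d\<close>; the finitely many positive ones survive a small step.\<close>

lemma perturb_gaps:
  assumes c: "c \<in> heights" and d: "d \<in> heights"
    and pos: "\<And>a b. crossing a b \<Longrightarrow> \<not> Q a b \<Longrightarrow> gap (($) c) a b > 0"
    and zero: "\<And>a b. crossing a b \<Longrightarrow> Q a b \<Longrightarrow> gap (($) c) a b = 0 \<and> gap (($) d) a b = 0"
  shows "\<exists>e>0. c + e *\<^sub>R d \<in> height_cone"
proof -
  let ?I = "{(a, b). crossing a b \<and> \<not> Q a b}"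
  obtain e where e: "e > 0"
    "\<And>i. i \<in> ?I \<Longrightarrow> e * (case i of (a, b) \<Rightarrow> - gap (($) d) a b) < (case i of (a, b) \<Rightarrow> gap (($) c) a b)"
    using small_multiple_less[of ?I "\<lambda>(a, b). gap (($) c) a b" "\<lambda>(a, b). - gap (($) d) a b"] pos
    by auto
  have "gap (($) (c + e *\<^sub>R d)) a b \<ge> 0" if cr: "crossing a b" for a b
    unfolding linear_add[OF linear_gap] linear_scale[OF linear_gap]
    using zero[OF cr] e(2)[of "(a, b)"] cr by (cases "Q a b") auto
  moreover have "c + e *\<^sub>R d \<in> heights"
    using c d subspace_heights by (auto intro!: subspace_add subspace_scale)
  ultimately show ?thesis using e(1) by (auto simp: height_cone_def)
qed

lemma aff_dim_height_cone: "aff_dim height_cone = int (dim heights)"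
proof -
  obtain c where c: "c \<in> heights" "\<And>a b. crossing a b \<Longrightarrow> gap (($) c) a b > 0"
    using exists_strict_height by blast
  show ?thesis
  proof (rule aff_dim_absorbing[OF subspace_heights])
    show "height_cone \<subseteq> heights" by (auto simp: height_cone_def)
    show "c \<in> height_cone" using c by (force simp: height_cone_def)
    show "\<exists>e>0. c + e *\<^sub>R d \<in> height_cone" if "d \<in> heights" for d
      using perturb_gaps[OF c(1) that, of "\<lambda>_ _. False"] c(2) by blast
  qed
qed

lemma extremal_pair_iff:
  assumes "crossing t t'"
  shows "extremal_pair E t t' \<longleftrightarrow> {h \<in> height_cone. gap (($) h) t t' = 0} facet_of height_cone"
proof -
  have "\<forall>h\<in>height_cone. h $ t + h $ t' \<ge> h $ (t \<union> t') + (\<Sum>s\<in>components_on E (t \<inter> t'). h $ s)"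
    using assms by (auto simp: height_cone_def gap_def csum_def algebra_simps)
  moreover have "{h \<in> height_cone. h $ t + h $ t' = h $ (t \<union> t') + (\<Sum>s\<in>components_on E (t \<inter> t'). h $ s)}
      = {h \<in> height_cone. gap (($) h) t t' = 0}"
    by (auto simp: gap_def csum_def)
  ultimately show ?thesis unfolding extremal_pair_def defines_facet_def closure_type_cone by simp
qed

lemma extremal_pair_sym: "extremal_pair E t t' \<longleftrightarrow> extremal_pair E t' t"
  by (simp add: extremal_pair_def Un_commute Int_commute add.commute)

section \<open>Pairs with a removable vertex\<close>

text \<open>Vanishing of the pair's gap forces two independent nonnegative gaps to vanish, so its
  face has codimension at least 2.\<close>

lemma not_extremal_if_removable:
  assumes cr: "crossing t t'" and v: "v \<in> t - t'" "\<exists>y\<in>t'. E v y"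
    and w: "w \<in> t - t'" "w \<noteq> v" "t - {w} \<in> tubes E"
  shows "\<not> extremal_pair E t t'"
proof
  assume "extremal_pair E t t'"
  let ?F = "{h \<in> height_cone. gap (($) h) t t' = 0}"
  let ?U = "t \<union> t' - {w}"
  let ?g1 = "\<lambda>h :: real ^ ('v set). gap (($) h) (t - {w}) t'"
  let ?g2 = "\<lambda>h :: real ^ ('v set). gap (($) h) t ?U"
  have facet: "?F facet_of height_cone" using \<open>extremal_pair E t t'\<close> extremal_pair_iff[OF cr] by simp
  have tt: "t \<in> tubes E" "t' \<in> tubes E" "t \<union> t' \<in> tubes E" "\<not> t \<subseteq> t'" "\<not> t' \<subseteq> t"
    using cr by (auto simp: crossing_def)
  have U: "(t - {w}) \<union> t' = ?U" "t \<union> ?U = t \<union> t'" "(t - {w}) \<inter> t' = t \<inter> t'" "t \<inter> ?U = t - {w}"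
    using w by blast+
  \<comment> \<open>The vertex \<open>v\<close> remains in \<open>t - {w}\<close>, and its edge to
    \<open>t'\<close> keeps the union connected.\<close>
  have Ut: "?U \<in> tubes E"
    unfolding U(1)[symmetric] by (rule tube_Un[OF w(3) tt(2)]) (use v w in blast)
  have c1: "crossing (t - {w}) t'" unfolding crossing_def U(1) using w v tt Ut by blast
  have c2: "crossing t ?U" unfolding crossing_def U(2) using w v tt Ut by blast
  have sum: "gap (($) h) t t' = ?g1 h + ?g2 h" for h :: "real ^ ('v set)"
    unfolding gap_def U by (simp add: csum_tube[OF w(3)])
  let ?M = "heights \<inter> {h. ?g1 h = 0}"
  have e: "axis t 1 \<in> heights" "axis t' 1 \<in> heights"
    using axis_heights[of t "t \<union> t'"] axis_heights[of t' "t \<union> t'"] tt by blast+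
  have nK: "t' \<notin> components_on E (t \<inter> t')" "t \<notin> components_on E (t \<inter> t')"
    using component_subset[of t' "t \<inter> t'"] component_subset[of t "t \<inter> t'"] tt by blast+
  have neq: "t - {w} \<noteq> t'" "?U \<noteq> t'" "t - {w} \<noteq> t" "?U \<noteq> t" "t' \<noteq> t" "t \<union> t' \<noteq> t"
    using v w tt by blast+
  \<comment> \<open>Independence of the gaps: \<open>?g1\<close> sees the axis of \<open>t'\<close>,
    while the axis of \<open>t\<close> is seen by \<open>?g2\<close> but not by
    \<open>?g1\<close>.\<close>
  have v1: "?g1 (axis t' 1) = 1" "?g1 (axis t 1) = 0" "?g2 (axis t 1) = 1"
    unfolding gap_def csum_axis U using nK neq
    by (simp_all add: axis_def components_tube[OF w(3)])
  have M: "subspace ?M" by (rule subspace_Int_kernel[OF subspace_heights linear_gap])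
  have "dim heights = dim ?M + 1"
    using dim_Int_kernel[OF subspace_heights linear_gap e(2)] v1 by simp
  moreover have "dim ?M = dim (?M \<inter> {h. ?g2 h = 0}) + 1"
    using dim_Int_kernel[OF M linear_gap[of t ?U], of "axis t 1"] e v1 by simp
  moreover have "?F \<subseteq> ?M \<inter> {h. ?g2 h = 0}"
  proof
    fix h assume h: "h \<in> ?F"
    then have "?g1 h \<ge> 0" "?g2 h \<ge> 0" "?g1 h + ?g2 h = 0"
      using c1 c2 sum[of h] by (auto simp: height_cone_def)
    then show "h \<in> ?M \<inter> {h. ?g2 h = 0}" using h by (auto simp: height_cone_def)
  qed
  then have "aff_dim ?F \<le> aff_dim (?M \<inter> {h. ?g2 h = 0})" by (rule aff_dim_subset)
  then have "aff_dim ?F \<le> int (dim (?M \<inter> {h. ?g2 h = 0}))"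
    using aff_dim_subspace[OF subspace_Int_kernel[OF M linear_gap[of t ?U]]] by simp
  ultimately have "aff_dim ?F < aff_dim height_cone - 1"
    unfolding aff_dim_height_cone by linarith
  then show False using facet by (simp add: facet_of_def)
qed

section \<open>Maximal pairs\<close>

text \<open>Serves to bound the intersection term of the height below. The summand 3/2 makes the
  empty family an equality; the induction step needs terms of at least 3, hence nonempty
  sets.\<close>

lemma sum_power3_card_le:
  assumes "finite A" "\<And>s. s \<in> A \<Longrightarrow> s \<noteq> {} \<and> finite s"
  shows "(\<Sum>s\<in>A. 3 ^ card s) + 3/2 \<le> (3/2 :: real) * 3 ^ (\<Sum>s\<in>A. card s)"
  using assms
proof (induction A rule: finite_induct)
  case (insert s A)
  let ?x = "3 ^ card s :: real" and ?y = "3 ^ (\<Sum>s\<in>A. card s) :: real"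
  have "card s \<ge> 1" using insert.prems[of s] by (simp add: Suc_le_eq card_gt_0_iff)
  then have x: "?x \<ge> 3" using power_increasing[of 1 "card s" "3::real"] by simp
  have y: "?y \<ge> 1" by simp
  have "(?x - 1) * (?y - 1) \<ge> 0" using x y by (intro mult_nonneg_nonneg) auto
  then have "?x + 3/2 * ?y \<le> 3/2 * (?x * ?y)" using x by (simp add: algebra_simps)
  then show ?case using insert by (simp add: power_add)
qed simp

text \<open>On the heights \<open>- 3 ^ card s\<close> all gaps are positive; lowering \<open>t\<close> and \<open>t'\<close> until their
  own gap vanishes keeps the other gaps positive because \<open>t\<close> and \<open>t'\<close> miss just one vertex
  of their union.\<close>

lemma exists_height_only_tight_at:
  assumes cr: "crossing t t'" and v: "v \<in> t - t'" "v' \<in> t' - t" "t - {v} = t' - {v'}"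
  obtains h where "h \<in> heights" "gap (($) h) t t' = 0"
    "\<And>a b. crossing a b \<Longrightarrow> {a, b} \<noteq> {t, t'} \<Longrightarrow> gap (($) h) a b > 0"
proof -
  define n where "n = card t"
  define \<sigma> :: real where "\<sigma> = (\<Sum>s\<in>components_on E (t \<inter> t'). 3 ^ card s)"
  \<comment> \<open>The common value at \<open>t\<close> and \<open>t'\<close> is half of
    \<open>f (t \<union> t') + csum f (t \<inter> t')\<close>, since the union has
    \<open>Suc n\<close> vertices and the intersection contributes
    \<open>- \<sigma>\<close>.\<close>
  define f :: "'v set \<Rightarrow> real" where
    "f s = (if s \<in> {t, t'} then - ((3 ^ Suc n + \<sigma>) / 2) else - (3 ^ card s))" for s
  have S: "t \<inter> t' = t - {v}" "t = insert v (t \<inter> t')" "t' = insert v' (t \<inter> t')"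
    "t \<union> t' = insert v' t" using v by blast+
  have cS: "n = Suc (card (t \<inter> t'))" using v arg_cong[OF S(2), of card] by (simp add: n_def)
  have cU: "card (t \<union> t') = Suc n" using v by (simp add: S(4) n_def)
  have "card t' = n" using v arg_cong[OF S(3), of card] by (simp add: cS)
  have "(\<Sum>s\<in>components_on E (t \<inter> t'). card s) = card (\<Union>(components_on E (t \<inter> t')))"
    by (rule card_Union_disjoint[symmetric, OF disjoint_components]) simp
  also have "\<dots> = card (t \<inter> t')" by (simp add: Union_components)
  finally have "\<sigma> + 3/2 \<le> 3/2 * 3 ^ card (t \<inter> t')"
    using sum_power3_card_le[of "components_on E (t \<inter> t')"] component_tube tube_nonempty
    unfolding \<sigma>_def by fastforce
  also have "\<dots> \<le> 3 ^ n" by (simp add: cS)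
  finally have \<sigma>n: "\<sigma> < 3 ^ n" by simp
  have \<sigma>0: "\<sigma> \<ge> 0" by (simp add: \<sigma>_def sum_nonneg)
  have f3: "f s \<le> - (3 ^ card s)" for s
    using \<sigma>0 \<open>card t' = n\<close> by (auto simp: f_def n_def)
  have "gap f a b > 0" if ab: "crossing a b" "{a, b} \<noteq> {t, t'}" for a b
  proof -
    let ?m = "3 ^ card (a \<union> b) :: real"
    have m: "3 * 3 ^ card a \<le> ?m" "3 * 3 ^ card b \<le> ?m"
      using power_increasing[of "Suc (card a)" "card (a \<union> b)" "3::real"]
        power_increasing[of "Suc (card b)" "card (a \<union> b)" "3::real"] crossing_card[OF ab(1)] by auto
    have ms: "3 * 3 ^ card s \<le> ?m" if "s \<in> {a, b}" for s using that m by blast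
    \<comment> \<open>As \<open>\<sigma> < 3 ^ n\<close>, a lowered value exceeds
      \<open>- (2 * 3 ^ n)\<close>, which is at least \<open>- (2/3 * ?m)\<close>. At most one of
      \<open>a\<close> and \<open>b\<close> is lowered, and the other costs at most
      \<open>1/3 * ?m\<close>.\<close>
    have low_t: "f s > - (2/3 * ?m)" if "s \<in> {a, b}" "s \<in> {t, t'}" for s
    proof -
      have "card s = n" using that(2) \<open>card t' = n\<close> n_def by (metis insertE singletonD)
      then have "3 * 3 ^ n \<le> ?m" using ms[OF that(1)] by simp
      moreover have "f s = - ((3 * 3 ^ n + \<sigma>) / 2)" using that(2) by (simp add: f_def)
      moreover have "(3 * x + y) / 2 < 2/3 * z" if "3 * x \<le> z" "y < x" for x y z :: real
        using that by (simp add: field_simps)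
      ultimately show ?thesis using \<sigma>n by simp
    qed
    have low: "f s \<ge> - (1/3 * ?m)" if "s \<in> {a, b}" "s \<notin> {t, t'}" for s
    proof -
      have "f s = - (3 ^ card s)" using that(2) by (simp add: f_def)
      then show ?thesis using ms[OF that(1)] by linarith
    qed
    have "a \<noteq> b" using ab(1) by (auto simp: crossing_def)
    then consider "a \<notin> {t, t'}" "b \<notin> {t, t'}" | "a \<in> {t, t'}" "b \<notin> {t, t'}"
      | "a \<notin> {t, t'}" "b \<in> {t, t'}" using ab(2) by blast
    then have "f a + f b > - ?m"
    proof cases
      case 1
      have "x + y > - z" if "x \<ge> - (1/3 * z)" "y \<ge> - (1/3 * z)" "z > 0" for x y z :: real
        using that by (simp add: field_simps)
      from this[OF low[of a] low[of b]] show ?thesis using 1 by simp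
    next
      case 2
      then show ?thesis using low_t[of a] low[of b] by simp
    next
      case 3
      then show ?thesis using low[of a] low_t[of b] by simp
    qed
    moreover have "f (a \<union> b) \<le> - ?m" by (rule f3)
    moreover have "csum f (a \<inter> b) \<le> 0"
      unfolding csum_def by (intro sum_nonpos order_trans[OF f3]) simp
    ultimately show ?thesis by (simp add: gap_def)
  qed
  moreover have "gap f t t' = 0"
  proof -
    have "s \<notin> {t, t'}" if "s \<in> components_on E (t \<inter> t')" for s
      using component_subset[OF that] v by blast
    then have "csum f (t \<inter> t') = (\<Sum>s\<in>components_on E (t \<inter> t'). - (3 ^ card s))"
      unfolding csum_def by (intro sum.cong) (auto simp: f_def)
    also have "\<dots> = - \<sigma>" by (simp add: \<sigma>_def sum_negf)
    moreover have "t \<union> t' \<noteq> t" "t \<union> t' \<noteq> t'" using v by blast+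
    ultimately show ?thesis using cU by (simp add: gap_def f_def)
  qed
  moreover obtain h where "h \<in> heights" "\<And>a b. crossing a b \<Longrightarrow> gap (($) h) a b = gap f a b"
    using exists_height_with_gaps[of f] by blast
  ultimately show ?thesis using that[of h] cr by simp
qed

lemma convex_height_cone: "convex height_cone"
proof (rule convexI)
  fix x y and u v :: real
  assume "x \<in> height_cone" "y \<in> height_cone" "u \<ge> 0" "v \<ge> 0"
  then show "u *\<^sub>R x + v *\<^sub>R y \<in> height_cone"
    using subspace_heights unfolding height_cone_def mem_Collect_eq
    by (auto simp: linear_add[OF linear_gap] linear_scale[OF linear_gap] subspace_add subspace_scale)
qed

lemma gap_sym: "gap f a b = gap f b a"
  by (simp add: gap_def Un_commute Int_commute)

text \<open>At the height tight only at this pair, all other gaps survive small moves inside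
  \<open>?g h = 0\<close>. So the face spans that hyperplane of \<open>heights\<close> and has
  codimension 1.\<close>

lemma extremal_if_maximal:
  assumes cr: "crossing t t'" and v: "v \<in> t - t'" "v' \<in> t' - t" "t - {v} = t' - {v'}"
  shows "extremal_pair E t t'"
proof -
  let ?g = "\<lambda>h :: real ^ ('v set). gap (($) h) t t'"
  let ?F = "{h \<in> height_cone. ?g h = 0}"
  let ?M = "heights \<inter> {h. ?g h = 0}"
  \<comment> \<open>The adjoint writes the gap as an inner product, which exhibits the face as cut
    out by a supporting hyperplane.\<close>
  have "?F = height_cone \<inter> {h. adjoint ?g 1 \<bullet> h = 0}"
    using adjoint_works[OF linear_gap[of t t'], of _ 1] by (auto simp: inner_commute)
  moreover have "adjoint ?g 1 \<bullet> h \<ge> 0" if "h \<in> height_cone" for h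
    using adjoint_works[OF linear_gap[of t t'], of h 1] cr that
    by (auto simp: inner_commute height_cone_def)
  ultimately have "?F face_of height_cone"
    using face_of_Int_supporting_hyperplane_ge[OF convex_height_cone] by metis
  obtain g where g: "g \<in> heights" "?g g = 0"
    "\<And>a b. crossing a b \<Longrightarrow> {a, b} \<noteq> {t, t'} \<Longrightarrow> gap (($) g) a b > 0"
    using exists_height_only_tight_at[OF cr v] by blast
  have pair: "gap (($) h) a b = ?g h" if "{a, b} = {t, t'}" for a b and h :: "real ^ ('v set)"
    using that gap_sym[of "($) h" t t'] by (auto simp: doubleton_eq_iff)
  have gC: "g \<in> height_cone"
    unfolding height_cone_def mem_Collect_eq using g pair by (metis order.order_iff_strict)
  have "subspace ?M" by (rule subspace_Int_kernel[OF subspace_heights linear_gap])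
  then have "aff_dim ?F = int (dim ?M)"
  proof (rule aff_dim_absorbing)
    show "?F \<subseteq> ?M" by (auto simp: height_cone_def)
    show "g \<in> ?F" using gC g by simp
    fix d assume d: "d \<in> ?M"
    have "\<exists>e>0. g + e *\<^sub>R d \<in> height_cone"
    proof (rule perturb_gaps[OF g(1), where Q = "\<lambda>a b. {a, b} = {t, t'}"])
      show "d \<in> heights" using d by simp
      show "gap (($) g) a b > 0" if "crossing a b" "{a, b} \<noteq> {t, t'}" for a b
        using g(3) that .
      show "gap (($) g) a b = 0 \<and> gap (($) d) a b = 0" if "{a, b} = {t, t'}" for a b
        using pair[OF that] g(2) d by simp
    qed
    then obtain e where "e > 0" "g + e *\<^sub>R d \<in> height_cone" by blast
    moreover have "?g (g + e *\<^sub>R d) = 0"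
      unfolding linear_add[OF linear_gap] linear_scale[OF linear_gap] using d g by simp
    ultimately show "\<exists>e>0. g + e *\<^sub>R d \<in> ?F" by blast
  qed
  moreover have "dim heights = dim ?M + 1"
  proof -
    obtain c where "c \<in> heights" "\<And>a b. crossing a b \<Longrightarrow> gap (($) c) a b > 0"
      using exists_strict_height by blast
    then show ?thesis using dim_Int_kernel[OF subspace_heights linear_gap[of t t'], of c] cr by force
  qed
  ultimately have "aff_dim ?F = aff_dim height_cone - 1" by (simp add: aff_dim_height_cone)
  then show ?thesis
    using \<open>?F face_of height_cone\<close> gC g(2) unfolding extremal_pair_iff[OF cr] facet_of_def by blast
qed

text \<open>A second vertex in \<open>t - t'\<close> or in \<open>t' - t\<close> would make some
  vertex removable and spoil extremality, so each difference consists of its one vertex adjacent to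
  the other tube.\<close>

lemma extremal_iff_maximal:
  assumes ex: "exchangeable E t t'"
  shows "extremal_pair E t t' \<longleftrightarrow> maximal_pair E t t'"
proof
  obtain v where v: "crossing t t'" "v \<in> t - t'" "\<exists>w\<in>t'. E v w"
    "\<forall>y\<in>t - t'. \<forall>w\<in>t'. E y w \<longrightarrow> y = v"
    using exchangeable_gateway[OF ex] by blast
  obtain v' where v': "crossing t' t" "v' \<in> t' - t" "\<exists>w\<in>t. E v' w"
    "\<forall>y\<in>t' - t. \<forall>w\<in>t. E y w \<longrightarrow> y = v'"
    using exchangeable_gateway[OF exchangeable_sym[OF ex]] by blast
  {
    assume "maximal_pair E t t'"
    then show "extremal_pair E t t'"
      unfolding maximal_pair_def using extremal_if_maximal[OF v(1)] by blast
  next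
    assume ext: "extremal_pair E t t'"
    have "t - t' = {v}"
    proof (rule ccontr)
      assume "t - t' \<noteq> {v}"
      then obtain w where "w \<in> t - t'" "w \<noteq> v" "t - {w} \<in> tubes E"
        using removable_vertex[OF v(1,2,4)] by blast
      then show False using not_extremal_if_removable[OF v(1-3)] ext by blast
    qed
    moreover have "t' - t = {v'}"
    proof (rule ccontr)
      assume "t' - t \<noteq> {v'}"
      then obtain w where "w \<in> t' - t" "w \<noteq> v'" "t' - {w} \<in> tubes E"
        using removable_vertex[OF v'(1,2,4)] by blast
      then show False
        using not_extremal_if_removable[OF v'(1-3)] ext extremal_pair_sym by blast
    qed
    ultimately have "t - {v} = t' - {v'}" by blast
    then show "maximal_pair E t t'" unfolding maximal_pair_def using v v' by blast
  }
qed

end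

theorem theorem2p10:
  fixes E :: "'v::finite \<Rightarrow> 'v \<Rightarrow> bool" and t t' :: "'v set"
  assumes "symp E" and "irreflp E"
    and "exchangeable E t t'"
  shows "extremal_pair E t t' \<longleftrightarrow> maximal_pair E t t'"
proof -
  interpret undirected_graph E by unfold_locales (rule assms(1))
  show ?thesis using assms(3) by (rule extremal_iff_maximal)
qed

end
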